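(* Let $G=\langle S\mid R\rangle$ be a finitely presented group given by a symmetric triangular presentation, and suppose its generalized Dowling geometry $M$ is almost multilinear. Then $s\neq s'$ in $G$ for all distinct $s,s'\in S$.
   Context: A presentation $\langle S\mid R\rangle$ is symmetric triangular if: $S,R$ finite, $e\in S$; for $e\neq s\in S$ a formal inverse $s^{-1}\in S$ with $ss^{-1}e\in R$; all relators are length-three words in $S$; if $abc\in R$ then $bca,cab,c^{-1}b^{-1}a^{-1}\in R$; $eee\in R$. Its generalized Dowling geometry is the simple rank-3 matroid on $E=\{b_1,b_2,b_3\}\cup\{s_i:s\in S,1\le i\le3\}$ in which a 3-element subset is dependent iff it lies in one of $\{b_1,b_2\}\cup\{s_1\}_{s\in S}$, $\{b_2,b_3\}\cup\{s_2\}_{s\in S}$, $\{b_3,b_1\}\cup\{s_3\}_{s\in S}$, or $\{s_i,s'_j,s''_k\}$ for a relator $s''s's\in R$ and a cyclic shift $(i,j,k)$ of $(1,2,3)$; sets of size $\le2$ are independent. A matroid $(E,r)$ is almost multilinear if for every $\varepsilon>0$ there are a vector space $V$ (over some field), subspaces $\{W_e\}_{e\in E}$ and $c\in\mathbb N$ with $\max_{S\subseteq E}|r(S)-\frac1c\dim\sum_{e\in S}W_e|<\varepsilon$. *)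

theory Defs
  imports Complex_Main "Jordan_Normal_Form.Missing_VectorSpace"
begin

section \<open>Group presentations\<close>

text \<open>
  A letter \<open>(s, True)\<close> stands for the generator \<open>s\<close> and \<open>(s, False)\<close> for its inverse in the free
  group; relators are positive words, given as lists of generators.
\<close>

definition words :: "'a set \<Rightarrow> ('a \<times> bool) list set" where
  "words S = lists (S \<times> UNIV)"

definition pos_word :: "'a list \<Rightarrow> ('a \<times> bool) list" where
  "pos_word = map (\<lambda>s. (s, True))"

inductive pres_eq :: "'a set \<Rightarrow> 'a list set \<Rightarrow> ('a \<times> bool) list \<Rightarrow> ('a \<times> bool) list \<Rightarrow> bool"
  for S :: "'a set" and R :: "'a list set" where
  refl: "w \<in> words S \<Longrightarrow> pres_eq S R w w"
| sym: "pres_eq S R u v \<Longrightarrow> pres_eq S R v u"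
| trans: "pres_eq S R u v \<Longrightarrow> pres_eq S R v w \<Longrightarrow> pres_eq S R u w"
| cancel: "u @ [(s, b), (s, \<not> b)] @ v \<in> words S \<Longrightarrow>
    pres_eq S R (u @ [(s, b), (s, \<not> b)] @ v) (u @ v)"
| relator: "r \<in> R \<Longrightarrow> u @ pos_word r @ v \<in> words S \<Longrightarrow>
    pres_eq S R (u @ pos_word r @ v) (u @ v)"

definition pres_rel :: "'a set \<Rightarrow> 'a list set \<Rightarrow> (('a \<times> bool) list \<times> ('a \<times> bool) list) set" where
  "pres_rel S R = {(u, v). pres_eq S R u v}"

definition presented_group :: "'a set \<Rightarrow> 'a list set \<Rightarrow> ('a \<times> bool) list set monoid" where
  "presented_group S R =
    \<lparr>carrier = words S // pres_rel S R,
     mult = (\<lambda>A B. \<Union>u\<in>A. \<Union>v\<in>B. pres_rel S R `` {u @ v}),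
     one = pres_rel S R `` {[]}\<rparr>"

definition pres_gen :: "'a set \<Rightarrow> 'a list set \<Rightarrow> 'a \<Rightarrow> ('a \<times> bool) list set" where
  "pres_gen S R s = pres_rel S R `` {[(s, True)]}"

lemma words_append [simp]: "u @ v \<in> words S \<longleftrightarrow> u \<in> words S \<and> v \<in> words S"
  by (auto simp: words_def)

lemma words_Nil [simp]: "[] \<in> words S"
  by (simp add: words_def)

lemma words_Cons [simp]: "x # v \<in> words S \<longleftrightarrow> fst x \<in> S \<and> v \<in> words S"
  by (cases x) (auto simp: words_def)

lemma pres_eq_words: "pres_eq S R u v \<Longrightarrow> u \<in> words S \<and> v \<in> words S"
  by (induction rule: pres_eq.induct) auto

lemma equiv_pres_rel: "equiv (words S) (pres_rel S R)"
proof (rule equivI)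
  show "pres_rel S R \<subseteq> words S \<times> words S"
    by (auto simp: pres_rel_def dest: pres_eq_words)
  show "refl_on (words S) (pres_rel S R)"
    by (auto simp: refl_on_def pres_rel_def intro: pres_eq.refl)
  show "sym_on UNIV (pres_rel S R)"
    by (auto simp: sym_on_def pres_rel_def intro: pres_eq.sym)
  show "trans_on UNIV (pres_rel S R)"
    by (auto simp: trans_on_def pres_rel_def intro: pres_eq.trans)
qed

lemma pres_eq_context:
  assumes "pres_eq S R u v" "x \<in> words S" "y \<in> words S"
  shows "pres_eq S R (x @ u @ y) (x @ v @ y)"
  using assms(1)
proof (induction rule: pres_eq.induct)
  case (refl w)
  then show ?case using assms by (intro pres_eq.refl) simp
next
  case (sym u v)
  show ?case by (rule pres_eq.sym[OF sym.IH])
next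
  case (trans u v w)
  show ?case by (rule pres_eq.trans[OF trans.IH])
next
  case (cancel u s b v)
  then show ?case using assms pres_eq.cancel[of "x @ u" s b "v @ y" S R] by simp
next
  case (relator r u v)
  then show ?case using assms pres_eq.relator[of r R "x @ u" "v @ y" S] by simp
qed

lemma pres_eq_append:
  assumes "pres_eq S R u u'" "pres_eq S R v v'"
  shows "pres_eq S R (u @ v) (u' @ v')"
proof (rule pres_eq.trans)
  show "pres_eq S R (u @ v) (u' @ v)"
    using pres_eq_context[OF assms(1), of "[]" v] pres_eq_words[OF assms(2)] by simp
  show "pres_eq S R (u' @ v) (u' @ v')"
    using pres_eq_context[OF assms(2), of u' "[]"] pres_eq_words[OF assms(1)] by simp
qed

lemma class_eq_iff:
  assumes "u \<in> words S" "v \<in> words S"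
  shows "pres_rel S R `` {u} = pres_rel S R `` {v} \<longleftrightarrow> pres_eq S R u v"
  using eq_equiv_class_iff[OF equiv_pres_rel assms] by (auto simp: pres_rel_def)

lemma presented_group_mult_class:
  assumes "u \<in> words S" "v \<in> words S"
  shows "pres_rel S R `` {u} \<otimes>\<^bsub>presented_group S R\<^esub> pres_rel S R `` {v} = pres_rel S R `` {u @ v}"
proof -
  let ?C = "\<lambda>w. pres_rel S R `` {w}"
  have *: "?C (u' @ v') = ?C (u @ v)"
    if "u' \<in> pres_rel S R `` {u}" "v' \<in> pres_rel S R `` {v}" for u' v'
  proof -
    have "pres_eq S R u u'" "pres_eq S R v v'"
      using that by (auto simp: pres_rel_def)
    then have "pres_eq S R (u @ v) (u' @ v')"
      by (rule pres_eq_append)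
    then show ?thesis
      using class_eq_iff[of "u @ v" S "u' @ v'" R] pres_eq_words[of S R "u @ v" "u' @ v'"] by simp
  qed
  have "u \<in> ?C u" "v \<in> ?C v"
    using assms by (auto simp: pres_rel_def intro: pres_eq.refl)
  then have "(\<Union>u'\<in>?C u. \<Union>v'\<in>?C v. ?C (u @ v)) = ?C (u @ v)"
    by blast
  moreover have "(\<Union>u'\<in>?C u. \<Union>v'\<in>?C v. ?C (u' @ v')) = (\<Union>u'\<in>?C u. \<Union>v'\<in>?C v. ?C (u @ v))"
    by (intro SUP_cong HOL.refl *)
  ultimately show ?thesis
    unfolding presented_group_def monoid.simps by (rule HOL.trans[rotated])
qed

lemma pres_eq_inverse_word:
  assumes "w \<in> words S"
  shows "pres_eq S R (rev (map (\<lambda>(s, b). (s, \<not> b)) w) @ w) []"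
  using assms
proof (induction w)
  case Nil
  then show ?case by (simp add: pres_eq.refl)
next
  case (Cons x w)
  obtain s b where x: "x = (s, b)" by (cases x)
  let ?i = "rev (map (\<lambda>(s, b). (s, \<not> b)) w)"
  have IH: "pres_eq S R (?i @ w) []"
    using Cons by simp
  then have "?i \<in> words S"
    using pres_eq_words[OF IH] by simp
  then have "pres_eq S R (?i @ [(s, \<not> b), (s, \<not> \<not> b)] @ w) (?i @ w)"
    using Cons.prems x by (intro pres_eq.cancel) auto
  from pres_eq.trans[OF this IH] show ?case
    using x by simp
qed

lemma group_presented_group: "group (presented_group S R)"
proof (rule groupI)
  let ?G = "presented_group S R"
  have carr: "carrier ?G = (\<lambda>w. pres_rel S R `` {w}) ` words S"
    by (auto simp: presented_group_def quotient_def)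
  have one: "\<one>\<^bsub>?G\<^esub> = pres_rel S R `` {[]}"
    by (simp add: presented_group_def)
  show "x \<otimes>\<^bsub>?G\<^esub> y \<in> carrier ?G" if "x \<in> carrier ?G" "y \<in> carrier ?G" for x y
    using that by (auto simp: carr presented_group_mult_class)
  show "\<one>\<^bsub>?G\<^esub> \<in> carrier ?G"
    by (auto simp: carr one)
  show "x \<otimes>\<^bsub>?G\<^esub> y \<otimes>\<^bsub>?G\<^esub> z = x \<otimes>\<^bsub>?G\<^esub> (y \<otimes>\<^bsub>?G\<^esub> z)"
    if "x \<in> carrier ?G" "y \<in> carrier ?G" "z \<in> carrier ?G" for x y z
    using that by (auto simp: carr presented_group_mult_class)
  show "\<one>\<^bsub>?G\<^esub> \<otimes>\<^bsub>?G\<^esub> x = x" if "x \<in> carrier ?G" for x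
    using that by (auto simp: carr one presented_group_mult_class)
  show "\<exists>y\<in>carrier ?G. y \<otimes>\<^bsub>?G\<^esub> x = \<one>\<^bsub>?G\<^esub>" if x: "x \<in> carrier ?G" for x
  proof -
    obtain w where w: "w \<in> words S" "x = pres_rel S R `` {w}"
      using x by (auto simp: carr)
    let ?i = "rev (map (\<lambda>(s, b). (s, \<not> b)) w)"
    have e: "pres_eq S R (?i @ w) []"
      by (rule pres_eq_inverse_word[OF w(1)])
    have i: "?i \<in> words S"
      using pres_eq_words[OF e] by simp
    have "pres_rel S R `` {?i} \<otimes>\<^bsub>?G\<^esub> x = \<one>\<^bsub>?G\<^esub>"
      using e i w by (simp add: presented_group_mult_class one class_eq_iff)
    then show ?thesis
      using i by (auto simp: carr)
  qed
qed


section \<open>Symmetric triangular presentations\<close>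

text \<open>
  The formal inversion is a map \<open>iv\<close> on \<open>S\<close>. The relator \<open>c\<inverse>b\<inverse>a\<inverse>\<close> also has to make sense when the
  letter \<open>e\<close> occurs in \<open>abc\<close>; there \<open>e\<inverse>\<close> is read as \<open>e\<close>.
\<close>

definition symmetric_triangular :: "'a set \<Rightarrow> 'a list set \<Rightarrow> 'a \<Rightarrow> ('a \<Rightarrow> 'a) \<Rightarrow> bool" where
  "symmetric_triangular S R e iv \<longleftrightarrow>
     finite S \<and> finite R \<and> e \<in> S \<and>
     iv e = e \<and>
     (\<forall>s\<in>S. iv s \<in> S \<and> iv (iv s) = s) \<and>
     (\<forall>s\<in>S. s \<noteq> e \<longrightarrow> [s, iv s, e] \<in> R) \<and>
     (\<forall>r\<in>R. length r = 3 \<and> set r \<subseteq> S) \<and>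
     (\<forall>a b c. [a, b, c] \<in> R \<longrightarrow>
        [b, c, a] \<in> R \<and> [c, a, b] \<in> R \<and> [iv c, iv b, iv a] \<in> R) \<and>
     [e, e, e] \<in> R"

text \<open>
  Literally, \<open>e\<close> is only a central element of order three in \<open>\<langle>S | R\<rangle>\<close>, since every relator has
  length three. The intended reading, in which \<open>e\<close> is the identity and \<open>iv s\<close> the inverse of \<open>s\<close>,
  amounts to the additional relator \<open>[e]\<close>. It identifies exactly the same generators:
\<close>

definition deg :: "('a \<times> bool) list \<Rightarrow> int" where
  "deg w = (\<Sum>x\<leftarrow>w. if snd x then 1 else - 1)"

lemma pres_eq_deg:
  assumes "pres_eq S R u v" "\<forall>r\<in>R. length r = 3"
  shows "deg u mod 3 = deg v mod 3"
  using assms(1)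
proof (induction rule: pres_eq.induct)
  case (relator r u v)
  have "deg (pos_word r) = int (length r)" for r :: "'a list"
    by (induction r) (auto simp: deg_def pos_word_def)
  then have "deg (pos_word r) = 3"
    using relator assms(2) by simp
  then have "deg (u @ pos_word r @ v) = deg (u @ v) + 3"
    by (simp add: deg_def)
  then show ?case by simp
next
  case (cancel u s b v)
  then show ?case by (simp add: deg_def)
qed auto

lemma pres_eq_mono:
  assumes "pres_eq S R u v" "R \<subseteq> R'"
  shows "pres_eq S R' u v"
  using assms(1)
proof (induction rule: pres_eq.induct)
  case (relator r u v)
  then show ?case using assms(2) by (intro pres_eq.relator) auto
next
  case (cancel u s b v)
  then show ?case by (rule pres_eq.cancel)
next
  case (refl w)
  then show ?case by (rule pres_eq.refl)
next
  case (sym u v)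
  show ?case by (rule pres_eq.sym[OF sym.IH])
next
  case (trans u v w)
  show ?case by (rule pres_eq.trans[OF trans.IH])
qed

lemma symmetric_triangular_e_central:
  assumes st: "symmetric_triangular S R e iv" and s: "s \<in> S"
  shows "pres_eq S R [(s, b), (e, True)] [(e, True), (s, b)]"
proof -
  let ?eq = "pres_eq S R"
  have e: "e \<in> S" using st by (simp add: symmetric_triangular_def)
  have pos: "?eq [(s, True), (e, True)] [(e, True), (s, True)]"
  proof (cases "s = e")
    case True
    then show ?thesis using e by (simp add: pres_eq.refl)
  next
    case False
    define t where "t = iv s"
    have t: "t \<in> S" "t \<noteq> e" "iv t = s"
      using st s False unfolding symmetric_triangular_def t_def by (blast, metis, blast)
    have "[t, iv t, e] \<in> R"
      using st t(1,2) unfolding symmetric_triangular_def by blast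
    then have r1: "[t, s, e] \<in> R"
      using t(3) by simp
    have "[s, t, e] \<in> R"
      using st s False unfolding symmetric_triangular_def t_def by blast
    then have r2: "[t, e, s] \<in> R"
      using st unfolding symmetric_triangular_def by blast
    have 1: "?eq [(t, False), (t, True), (s, True), (e, True)] [(s, True), (e, True)]"
      using pres_eq.cancel[of "[]" t False "[(s, True), (e, True)]" S R] s e t by simp
    have 2: "?eq [(t, False), (t, True), (e, True), (s, True)] [(e, True), (s, True)]"
      using pres_eq.cancel[of "[]" t False "[(e, True), (s, True)]" S R] s e t by simp
    have 3: "?eq [(t, False), (t, True), (s, True), (e, True)] [(t, False)]"
      using pres_eq.relator[OF r1, of "[(t, False)]" "[]" S] s e t by (simp add: pos_word_def)
    have 4: "?eq [(t, False), (t, True), (e, True), (s, True)] [(t, False)]"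
      using pres_eq.relator[OF r2, of "[(t, False)]" "[]" S] s e t by (simp add: pos_word_def)
    show ?thesis
      by (rule pres_eq.trans[OF pres_eq.sym[OF 1] pres_eq.trans[OF 3 pres_eq.trans[OF pres_eq.sym[OF 4] 2]]])
  qed
  show ?thesis
  proof (cases b)
    case True
    then show ?thesis using pos by simp
  next
    case False
    have 1: "?eq [(s, False), (e, True), (s, True), (s, False)] [(s, False), (e, True)]"
      using pres_eq.cancel[of "[(s, False), (e, True)]" s True "[]" S R] s e by simp
    have 2: "?eq [(s, False), (s, True), (e, True), (s, False)] [(e, True), (s, False)]"
      using pres_eq.cancel[of "[]" s False "[(e, True), (s, False)]" S R] s e by simp
    have 3: "?eq [(s, False), (s, True), (e, True), (s, False)]
                 [(s, False), (e, True), (s, True), (s, False)]"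
      using pres_eq_context[OF pos, of "[(s, False)]" "[(s, False)]"] s by simp
    show ?thesis
      using pres_eq.trans[OF pres_eq.sym[OF 1] pres_eq.trans[OF pres_eq.sym[OF 3] 2]] False by simp
  qed
qed

lemma symmetric_triangular_e_central_word:
  assumes st: "symmetric_triangular S R e iv" and u: "u \<in> words S"
  shows "pres_eq S R (u @ [(e, True)]) ((e, True) # u)"
  using u
proof (induction u)
  case Nil
  then show ?case using st by (simp add: pres_eq.refl symmetric_triangular_def)
next
  case (Cons x u)
  obtain s b where x: "x = (s, b)" by (cases x)
  have s: "s \<in> S" and u: "u \<in> words S" using Cons.prems x by auto
  have 1: "pres_eq S R ([x] @ (u @ [(e, True)]) @ []) ([x] @ ((e, True) # u) @ [])"
    using Cons u s x by (intro pres_eq_context) auto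
  have 2: "pres_eq S R ([] @ [x, (e, True)] @ u) ([] @ [(e, True), x] @ u)"
    using symmetric_triangular_e_central[OF st s] u x by (intro pres_eq_context) auto
  show ?case
    using pres_eq.trans[of S R "[x] @ (u @ [(e, True)]) @ []"] 1 2 by simp
qed

lemma symmetric_triangular_e_power:
  assumes st: "symmetric_triangular S R e iv"
  shows "pres_eq S R (replicate (3 * k) (e, True)) []"
proof (induction k)
  case 0
  then show ?case by (simp add: pres_eq.refl)
next
  case (Suc k)
  have "[e, e, e] \<in> R" "e \<in> S" using st by (auto simp: symmetric_triangular_def)
  then have "pres_eq S R ([] @ pos_word [e, e, e] @ []) ([] @ [])"
    by (intro pres_eq.relator) (auto simp: pos_word_def)
  then have "pres_eq S R (pos_word [e, e, e] @ replicate (3 * k) (e, True)) ([] @ [])"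
    using Suc by (intro pres_eq_append) simp_all
  then show ?case by (simp add: pos_word_def replicate_add numeral_3_eq_3)
qed

lemma symmetric_triangular_insert_e:
  assumes st: "symmetric_triangular S R e iv" and "pres_eq S (insert [e] R) u v"
  shows "\<exists>k. pres_eq S R u (replicate k (e, True) @ v)"
  using assms(2)
proof (induction rule: pres_eq.induct)
  case (refl w)
  then show ?case by (intro exI[of _ 0]) (simp add: pres_eq.refl)
next
  case (sym u v)
  then obtain k where k: "pres_eq S R u (replicate k (e, True) @ v)" by blast
  have "e \<in> S"
    using st by (simp add: symmetric_triangular_def)
  then have p: "replicate (2 * k) (e, True) \<in> words S"
    by (auto simp: words_def)
  have v: "v \<in> words S"
    using pres_eq_words[OF k] by simp
  have "replicate (3 * k) (e, True) = replicate (2 * k + k) (e, True)"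
    by simp
  then have r: "replicate (2 * k) (e, True) @ replicate k (e, True) @ v = replicate (3 * k) (e, True) @ v"
    unfolding replicate_add by simp
  have 1: "pres_eq S R (replicate (2 * k) (e, True) @ u) (replicate (3 * k) (e, True) @ v)"
    using pres_eq_append[OF pres_eq.refl[OF p] k] unfolding r .
  have 2: "pres_eq S R (replicate (3 * k) (e, True) @ v) v"
    using pres_eq_append[OF symmetric_triangular_e_power[OF st] pres_eq.refl[OF v]] by simp
  have "pres_eq S R v (replicate (2 * k) (e, True) @ u)"
    by (rule pres_eq.sym[OF pres_eq.trans[OF 1 2]])
  then show ?case by blast
next
  case (trans u v w)
  then obtain k l where k: "pres_eq S R u (replicate k (e, True) @ v)"
    and l: "pres_eq S R v (replicate l (e, True) @ w)" by blast
  have "replicate k (e, True) \<in> words S"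
    using pres_eq_words[OF k] by simp
  then have "pres_eq S R (replicate k (e, True) @ v) (replicate k (e, True) @ replicate l (e, True) @ w)"
    using l by (intro pres_eq_append pres_eq.refl)
  from pres_eq.trans[OF k this] have "pres_eq S R u (replicate (k + l) (e, True) @ w)"
    by (simp add: replicate_add)
  then show ?case by blast
next
  case (cancel u s b v)
  then show ?case by (intro exI[of _ 0]) (simp only: replicate_0 append_Nil pres_eq.cancel)
next
  case (relator r u v)
  show ?case
  proof (cases "r \<in> R")
    case True
    then show ?thesis
      using pres_eq.relator[OF True relator.hyps(2)] by (intro exI[of _ 0]) simp
  next
    case False
    then have r: "r = [e]" using relator by simp
    have "u \<in> words S" "v \<in> words S" using relator by auto
    then have "pres_eq S R ((u @ [(e, True)]) @ v) (((e, True) # u) @ v)"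
      by (intro pres_eq_append pres_eq.refl symmetric_triangular_e_central_word[OF st])
    then show ?thesis using r by (intro exI[of _ 1]) (simp add: pos_word_def)
  qed
qed

lemma symmetric_triangular_pres_gen_eq_iff:
  assumes st: "symmetric_triangular S R e iv" and s: "s \<in> S" and s': "s' \<in> S"
  shows "pres_gen S (insert [e] R) s = pres_gen S (insert [e] R) s' \<longleftrightarrow>
         pres_gen S R s = pres_gen S R s'"
proof -
  have "pres_eq S R [(s, True)] [(s', True)]"
    if eq: "pres_eq S (insert [e] R) [(s, True)] [(s', True)]"
  proof -
    obtain k where k: "pres_eq S R [(s, True)] (replicate k (e, True) @ [(s', True)])"
      using symmetric_triangular_insert_e[OF st eq] by blast
    have "deg [(s, True)] mod 3 = deg (replicate k (e, True) @ [(s', True)]) mod 3"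
      using st by (intro pres_eq_deg[OF k]) (simp add: symmetric_triangular_def)
    then have "(1::int) mod 3 = (int k + 1) mod 3"
      by (simp add: deg_def sum_list_replicate)
    then have "k mod 3 = 0" by presburger
    then obtain l where l: "k = 3 * l" by (metis dvd_eq_mod_eq_0 dvd_def)
    have "pres_eq S R (replicate k (e, True) @ [(s', True)]) ([] @ [(s', True)])"
      unfolding l using s' by (intro pres_eq_append pres_eq.refl symmetric_triangular_e_power[OF st]) simp
    from pres_eq.trans[OF k this] show ?thesis by simp
  qed
  moreover have "pres_eq S (insert [e] R) [(s, True)] [(s', True)]"
    if "pres_eq S R [(s, True)] [(s', True)]"
    using pres_eq_mono[OF that] by blast
  ultimately show ?thesis
    using s s' by (auto simp: pres_gen_def class_eq_iff)
qed


section \<open>Matroids\<close>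

definition matroid :: "'e set \<Rightarrow> ('e set \<Rightarrow> bool) \<Rightarrow> bool" where
  "matroid E indep \<longleftrightarrow>
     finite E \<and>
     (\<forall>X. indep X \<longrightarrow> X \<subseteq> E) \<and>
     indep {} \<and>
     (\<forall>X Y. indep X \<longrightarrow> Y \<subseteq> X \<longrightarrow> indep Y) \<and>
     (\<forall>X Y. indep X \<longrightarrow> indep Y \<longrightarrow> card X < card Y \<longrightarrow> (\<exists>y\<in>Y - X. indep (insert y X)))"

definition matroid_rank :: "('e set \<Rightarrow> bool) \<Rightarrow> 'e set \<Rightarrow> nat" where
  "matroid_rank indep A = Max (card ` {X. X \<subseteq> A \<and> indep X})"

definition sum_subspaces ::
    "'k ring \<Rightarrow> ('k, 'v) module \<Rightarrow> ('e \<Rightarrow> 'v set) \<Rightarrow> 'e set \<Rightarrow> ('k, 'v) module" where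
  "sum_subspaces K V W A = V\<lparr>carrier := LinearCombinations.module.span K V (\<Union>x\<in>A. W x)\<rparr>"

text \<open>
  The field and the vector space may depend on \<open>\<epsilon>\<close>, so they are structures with carriers in the
  types \<open>'k\<close> and \<open>'v\<close>; a statement assuming this predicate for arbitrary \<open>'k\<close> and \<open>'v\<close> covers all
  fields and vector spaces. Finite-dimensionality is explicit because \<open>vectorspace.dim\<close> is an
  unspecified natural number for infinite-dimensional spaces.
\<close>

definition almost_multilinear ::
    "'k itself \<Rightarrow> 'v itself \<Rightarrow> 'e set \<Rightarrow> ('e set \<Rightarrow> bool) \<Rightarrow> bool" where
  "almost_multilinear _ _ E indep \<longleftrightarrow>
     matroid E indep \<and>
     (\<forall>\<epsilon>>0. \<exists>(K :: 'k ring) (V :: ('k, 'v) module) (W :: 'e \<Rightarrow> 'v set) (c :: nat).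
        c > 0 \<and> vectorspace K V \<and>
        (\<forall>x\<in>E. subspace K (W x) V) \<and>
        (\<forall>A\<subseteq>E. vectorspace.fin_dim K (sum_subspaces K V W A)) \<and>
        (MAX A\<in>Pow E. \<bar>real (matroid_rank indep A) -
            real (vectorspace.dim K (sum_subspaces K V W A)) / real c\<bar>) < \<epsilon>)"


section \<open>Generalized Dowling geometries\<close>

text \<open>\<open>Joint i\<close> is the point \<open>b\<^sub>i\<close> and \<open>Point s i\<close> is the point \<open>s\<^sub>i\<close>.\<close>

datatype 'a dowling_point = Joint nat | Point 'a nat

definition dowling_ground :: "'a set \<Rightarrow> 'a dowling_point set" where
  "dowling_ground S = {Joint 1, Joint 2, Joint 3} \<union> {Point s i | s i. s \<in> S \<and> i \<in> {1, 2, 3}}"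

definition dowling_lines :: "'a set \<Rightarrow> 'a list set \<Rightarrow> 'a dowling_point set set" where
  "dowling_lines S R =
     {{Joint 1, Joint 2} \<union> {Point s 1 | s. s \<in> S},
      {Joint 2, Joint 3} \<union> {Point s 2 | s. s \<in> S},
      {Joint 3, Joint 1} \<union> {Point s 3 | s. s \<in> S}} \<union>
     {{Point s i, Point s' j, Point s'' k} | s s' s'' i j k.
        [s'', s', s] \<in> R \<and> (i, j, k) \<in> {(1, 2, 3), (2, 3, 1), (3, 1, 2)}}"

text \<open>
  For some presentations this family of sets is not a matroid, e.g. if \<open>abc, abd \<in> R\<close> with \<open>c \<noteq> d\<close>.
  Then there is no generalized Dowling geometry, and \<open>almost_multilinear\<close> is false because
  of its matroid conjunct. (That conjunct is implied by the approximation property: the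
  rank function would be a limit of submodular functions.)
\<close>

definition dowling_indep :: "'a set \<Rightarrow> 'a list set \<Rightarrow> 'a dowling_point set \<Rightarrow> bool" where
  "dowling_indep S R X \<longleftrightarrow>
     X \<subseteq> dowling_ground S \<and>
     (card X \<le> 2 \<or> (card X = 3 \<and> \<not> (\<exists>L\<in>dowling_lines S R. X \<subseteq> L)))"

end

theory Submission
  imports Defs
begin

text \<open>
  In an approximate multilinear representation with scale \<open>c\<close>, shrinking the subspaces by \<open>O(\<epsilon> c)\<close>
  dimensions makes the three joints exactly independent and turns every point \<open>s\<^sub>i\<close> into the graph
  of a partial isomorphism between the joints \<open>b\<^sub>i\<close> and \<open>b\<^sub>i\<^sub>+\<^sub>1\<close>. A line coming from a relator says
  that going once around the triangle is the identity up to \<open>O(\<epsilon> c)\<close> dimensions. Hence words,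
  together with a starting joint, act by partial isomorphisms, and words that are equal in the
  group act equally on a subspace of codimension \<open>O(\<epsilon> c)\<close>, where the constant depends only on the
  derivation of the equality. All relators have length three, so the final joint depends only on
  the group element and the starting joint. If \<open>s = s'\<close> in the group with \<open>s \<noteq> s'\<close>, then \<open>s\<^sub>i\<close> and \<open>s'\<^sub>i\<close> share almost \<open>c\<close>
  dimensions for small \<open>\<epsilon>\<close>, although they span about \<open>2c\<close>.
\<close>

section \<open>Dimensions of subspaces\<close>

locale findim_vectorspace = vectorspace K V
  for K :: "('k, 'm) ring_scheme" and V :: "('k, 'v, 'n) module_scheme" +
  assumes findim: fin_dim
begin

abbreviation sub :: "'v set \<Rightarrow> bool" where
  "sub U \<equiv> subspace K U V"

abbreviation ssum :: "'v set \<Rightarrow> 'v set \<Rightarrow> 'v set" (infixl "\<^bold>+" 65) where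
  "U \<^bold>+ W \<equiv> subspace_sum U W"

definition sdim :: "'v set \<Rightarrow> nat" where
  "sdim U = vectorspace.dim K (vs U)"

section \<open>Closure properties of subspaces\<close>

lemma sub_carrier: "sub U \<Longrightarrow> U \<subseteq> carrier V"
  by (simp add: subspace_def submodule_def)

lemma sub_mem_carrier: "sub U \<Longrightarrow> x \<in> U \<Longrightarrow> x \<in> carrier V"
  using sub_carrier by blast

lemma sub_zero: "sub U \<Longrightarrow> \<zero>\<^bsub>V\<^esub> \<in> U"
  by (simp add: subspace_def submodule_def)

lemma sub_add: "sub U \<Longrightarrow> x \<in> U \<Longrightarrow> y \<in> U \<Longrightarrow> x \<oplus>\<^bsub>V\<^esub> y \<in> U"
  by (simp add: subspace_def submodule_def)

lemma sub_smult: "sub U \<Longrightarrow> a \<in> carrier K \<Longrightarrow> x \<in> U \<Longrightarrow> a \<odot>\<^bsub>V\<^esub> x \<in> U"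
  by (simp add: subspace_def submodule_def)

lemma sub_uminus: "sub U \<Longrightarrow> x \<in> U \<Longrightarrow> \<ominus>\<^bsub>V\<^esub> x \<in> U"
  using sub_smult[of U "\<ominus>\<^bsub>K\<^esub> \<one>\<^bsub>K\<^esub>" x] sub_mem_carrier[of U x] by (simp add: smult_minus_1)

lemma sub_minus: "sub U \<Longrightarrow> x \<in> U \<Longrightarrow> y \<in> U \<Longrightarrow> x \<ominus>\<^bsub>V\<^esub> y \<in> U"
  by (simp add: a_minus_def sub_add sub_uminus)

lemma sub_Int: "sub U \<Longrightarrow> sub W \<Longrightarrow> sub (U \<inter> W)"
  by (auto simp: subspace_def submodule_def)

lemma sub_ssum: "sub U \<Longrightarrow> sub W \<Longrightarrow> sub (U \<^bold>+ W)"
  by (rule sum_is_subspace)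

lemma mem_ssum: "x \<in> U \<^bold>+ W \<longleftrightarrow> (\<exists>u\<in>U. \<exists>w\<in>W. x = u \<oplus>\<^bsub>V\<^esub> w)"
  by (auto simp: submodule_sum_def)

lemma ssum_least: "sub X \<Longrightarrow> U \<subseteq> X \<Longrightarrow> W \<subseteq> X \<Longrightarrow> U \<^bold>+ W \<subseteq> X"
  by (auto simp: submodule_sum_def subset_iff sub_add)

lemma ssum_mono: "U \<subseteq> U' \<Longrightarrow> W \<subseteq> W' \<Longrightarrow> U \<^bold>+ W \<subseteq> U' \<^bold>+ W'"
  unfolding submodule_sum_def by (intro image_mono) auto

lemma span_sub: "sub U \<Longrightarrow> span U = U"
  using in_own_span[OF sub_carrier] span_is_subset[of U U] by (auto simp: subspace_def)

section \<open>Bases of subspaces and the modular law for dimensions\<close>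

text \<open>Independent sets have at most \<open>dim\<close> elements, so a maximal one between
  \<open>A\<close> and \<open>U\<close> exists, and maximality makes it span \<open>U\<close>. With
  \<open>A\<close> empty this yields a basis of \<open>U\<close>.\<close>

lemma sub_indpt_extend:
  assumes U: "sub U" and A: "A \<subseteq> U" "lin_indpt A"
  obtains C where "finite C" "A \<subseteq> C" "C \<subseteq> U" "lin_indpt C" "span C = U"
proof -
  interpret U: vectorspace K "vs U"
    by (rule subspace_is_vs[OF U])
  have sm: "submodule K U V" using U by simp
  define P where "P = (\<lambda>X. A \<subseteq> X \<and> X \<subseteq> U \<and> lin_indpt X)"
  have bd: "finite X \<and> card X \<le> dim" if "P X" for X
    using that li_le_dim[OF findim, of X] sub_carrier[OF U] by (auto simp: P_def)
  have "P A" using A by (auto simp: P_def)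
  then obtain C where C: "finite C" "maximal C P"
    using maximal_exists[of P dim A] bd by blast
  then have CP: "A \<subseteq> C" "C \<subseteq> U" "lin_indpt C" by (auto simp: maximal_def P_def)
  have "maximal C (\<lambda>X. X \<subseteq> carrier (vs U) \<and> U.lin_indpt X)"
    unfolding maximal_def
  proof (intro conjI allI impI)
    show "C \<subseteq> carrier (vs U)" using CP by simp
    show "U.lin_indpt C" using CP span_li_not_depend(2)[OF CP(2) sm] by simp
    fix X assume X: "C \<subseteq> X \<and> X \<subseteq> carrier (vs U) \<and> U.lin_indpt X"
    then have "P X" using CP span_li_not_depend(2)[of X U] sm by (auto simp: P_def)
    then show "X = C" using C X by (auto simp: maximal_def)
  qed
  then have "U.span C = U"
    using U.max_li_is_gen by simp
  then have "span C = U"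
    using span_li_not_depend(1)[OF CP(2) sm] by simp
  with C CP that show thesis by blast
qed

lemma sdim_card:
  assumes U: "sub U" and C: "finite C" "C \<subseteq> U" "lin_indpt C" "span C = U"
  shows "sdim U = card C"
proof -
  interpret U: vectorspace K "vs U"
    by (rule subspace_is_vs[OF U])
  have sm: "submodule K U V" using U by simp
  have "U.basis C"
    using C span_li_not_depend[OF C(2) sm] by (simp add: U.basis_def)
  from U.dim_basis[OF C(1) this] show ?thesis by (simp add: sdim_def)
qed

lemma lin_indpt_empty: "lin_indpt {}"
  by (auto simp: lin_dep_def)

text \<open>A nonzero vector in both spans, written once over \<open>A\<close> and once over
  \<open>C\<close>, gives a nontrivial relation on the union. Conversely, the two halves of a
  relation are negatives of each other, so each lies in both spans and vanishes.\<close>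

lemma indpt_Un_iff_span_disjoint:
  assumes "finite A" "finite C" "A \<subseteq> carrier V" "C \<subseteq> carrier V" "lin_indpt A" "lin_indpt C" "A \<inter> C = {}"
  shows "lin_indpt (A \<union> C) \<longleftrightarrow> span A \<inter> span C = {\<zero>\<^bsub>V\<^esub>}"
proof
  assume ind: "lin_indpt (A \<union> C)"
  have "x = \<zero>\<^bsub>V\<^esub>" if x: "x \<in> span A" "x \<in> span C" for x
  proof (rule ccontr)
    assume "x \<noteq> \<zero>\<^bsub>V\<^esub>"
    obtain a where a: "a \<in> A \<rightarrow> carrier K" "lincomb a A = x"
      using finite_in_span[OF assms(1,3) x(1)] by blast
    have "\<ominus>\<^bsub>V\<^esub> x \<in> span C" using span_neg[OF assms(4) x(2)] .
    then obtain c where c: "c \<in> C \<rightarrow> carrier K" "lincomb c C = \<ominus>\<^bsub>V\<^esub> x"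
      using finite_in_span[OF assms(2,4)] by blast
    have xc: "x \<in> carrier V" using a assms by blast
    \<comment> \<open>Coefficients of \<open>x\<close> on \<open>A\<close> and of its negative on
      \<open>C\<close>: the combination vanishes although some coefficient on \<open>A\<close> does
      not.\<close>
    let ?f = "\<lambda>v. if v \<in> A then a v else c v"
    have 0: "lincomb ?f (A \<union> C) = \<zero>\<^bsub>V\<^esub>"
      using module.lincomb_union2[of A C a c] a c assms xc M.r_neg by auto
    obtain v where v: "v \<in> A" "a v \<noteq> \<zero>\<^bsub>K\<^esub>"
      using \<open>x \<noteq> \<zero>\<^bsub>V\<^esub>\<close> a lincomb_zero[of A a] assms by blast
    have "lin_dep (A \<union> C)"
      by (rule lin_dep_crit[of "A \<union> C" "A \<union> C" ?f v]) (use 0 a c v assms in auto)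
    with ind show False by simp
  qed
  then show "span A \<inter> span C = {\<zero>\<^bsub>V\<^esub>}" using span_zero by auto
next
  assume disj: "span A \<inter> span C = {\<zero>\<^bsub>V\<^esub>}"
  show "lin_indpt (A \<union> C)"
  proof (rule finite_lin_indpt2)
    show "finite (A \<union> C)" "A \<union> C \<subseteq> carrier V" using assms by auto
    fix f assume f: "f \<in> A \<union> C \<rightarrow> carrier K" and 0: "lincomb f (A \<union> C) = \<zero>\<^bsub>V\<^esub>"
    have fA: "f \<in> A \<rightarrow> carrier K" and fC: "f \<in> C \<rightarrow> carrier K" using f by auto
    have cl: "lincomb f A \<in> carrier V" "lincomb f C \<in> carrier V"
      using fA fC assms by auto
    have "lincomb f A \<oplus>\<^bsub>V\<^esub> lincomb f C = \<zero>\<^bsub>V\<^esub>"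
      using 0 module.lincomb_union[of A C f] assms f by simp
    then have eq: "lincomb f A = \<ominus>\<^bsub>V\<^esub> lincomb f C"
      using cl by (metis M.minus_equality)
    have iA: "lincomb f A \<in> span A" and iC: "lincomb f C \<in> span C"
      using fA fC assms by (auto simp: finite_span)
    have "lincomb f A \<in> span C" unfolding eq by (rule span_neg[OF assms(4) iC])
    then have zA: "lincomb f A = \<zero>\<^bsub>V\<^esub>" using iA disj by auto
    then have zC: "lincomb f C = \<zero>\<^bsub>V\<^esub>" using eq cl M.minus_minus[of "lincomb f C"] by simp
    have "f v = \<zero>\<^bsub>K\<^esub>" if "v \<in> A" for v
      using not_lindepD[OF assms(5,1), of f] fA zA that by (auto simp: Pi_def)
    moreover have "f v = \<zero>\<^bsub>K\<^esub>" if "v \<in> C" for v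
      using not_lindepD[OF assms(6,2), of f] fC zC that by (auto simp: Pi_def)
    ultimately show "\<forall>v\<in>A \<union> C. f v = \<zero>\<^bsub>K\<^esub>" by auto
  qed
qed

text \<open>A basis of \<open>Z\<close> extends to a basis of \<open>X\<close>, and the added
  vectors span a complement.\<close>

lemma sub_complement:
  assumes X: "sub X" and Z: "sub Z" "Z \<subseteq> X"
  obtains T where "sub T" "T \<subseteq> X" "T \<inter> Z = {\<zero>\<^bsub>V\<^esub>}" "T \<^bold>+ Z = X"
proof -
  obtain A where A: "finite A" "A \<subseteq> Z" "lin_indpt A" "span A = Z"
    using sub_indpt_extend[OF Z(1), of "{}"] lin_indpt_empty by auto
  obtain C where C: "finite C" "A \<subseteq> C" "C \<subseteq> X" "lin_indpt C" "span C = X"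
    using sub_indpt_extend[OF X, of A] A Z by auto
  have Cc: "C \<subseteq> carrier V" using C sub_carrier[OF X] by blast
  have D: "lin_indpt (C - A)" by (rule subset_li_is_li[OF C(4)]) auto
  have AC: "A \<union> (C - A) = C" using C by auto
  show thesis
  proof (rule that)
    show "sub (span (C - A))" using Cc by (intro span_is_subspace) auto
    show "span (C - A) \<subseteq> X" using C by (metis Diff_subset span_is_monotone)
    show "span (C - A) \<inter> Z = {\<zero>\<^bsub>V\<^esub>}"
      using indpt_Un_iff_span_disjoint[of A "C - A"] A C Cc D AC by (auto simp: Int_commute)
    have "span (A \<union> (C - A)) = span A \<^bold>+ span (C - A)"
      using Cc C by (intro span_union_is_sum) auto
    then show "span (C - A) \<^bold>+ Z = X"
      using AC A C vsum_comm[of Z "span (C - A)"] Z Cc by (simp add: span_is_subspace subset_iff)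
  qed
qed

lemma sdim_ssum_disjoint:
  assumes U: "sub U" and W: "sub W" and disj: "U \<inter> W = {\<zero>\<^bsub>V\<^esub>}"
  shows "sdim (U \<^bold>+ W) = sdim U + sdim W"
proof -
  obtain A where A: "finite A" "A \<subseteq> U" "lin_indpt A" "span A = U"
    using sub_indpt_extend[OF U, of "{}"] lin_indpt_empty by auto
  obtain C where C: "finite C" "C \<subseteq> W" "lin_indpt C" "span C = W"
    using sub_indpt_extend[OF W, of "{}"] lin_indpt_empty by auto
  have c: "A \<subseteq> carrier V" "C \<subseteq> carrier V" using A C sub_carrier U W by auto
  have "\<zero>\<^bsub>V\<^esub> \<notin> A" using vs_zero_lin_dep c A by blast
  then have AC: "A \<inter> C = {}" using subset_trans[OF Int_mono[OF A(2) C(2)], of "{\<zero>\<^bsub>V\<^esub>}"] disj by (simp add: subset_singleton_iff) (metis Int_iff insertI1)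
  have li: "lin_indpt (A \<union> C)"
    using indpt_Un_iff_span_disjoint[of A C] A C c AC disj by auto
  have sp: "span (A \<union> C) = U \<^bold>+ W"
    using span_union_is_sum[OF c] A C by simp
  have "sdim (U \<^bold>+ W) = card (A \<union> C)"
    using in_own_span[of "A \<union> C"] c A C li sp by (intro sdim_card sub_ssum U W) auto
  also have "\<dots> = card A + card C" using A C AC by (simp add: card_Un_disjoint)
  finally show ?thesis using sdim_card[OF U] sdim_card[OF W] A C by simp
qed

lemma sdim_mono:
  assumes "sub U" "sub W" "U \<subseteq> W"
  shows "sdim U \<le> sdim W"
proof -
  obtain T where T: "sub T" "T \<subseteq> W" "T \<inter> U = {\<zero>\<^bsub>V\<^esub>}" "T \<^bold>+ U = W"
    using sub_complement[OF assms(2,1,3)] by blast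
  then show ?thesis using sdim_ssum_disjoint[OF T(1) assms(1) T(3)] by simp
qed

text \<open>For a complement \<open>T\<close> of U \<inter> W in \<open>W\<close>, the space
  \<open>W\<close> is the direct sum of \<open>T\<close> and U \<inter> W, while U + W is the direct
  sum of \<open>U\<close> and \<open>T\<close>.\<close>

lemma sdim_ssum_Int:
  assumes U: "sub U" and W: "sub W"
  shows "sdim (U \<^bold>+ W) + sdim (U \<inter> W) = sdim U + sdim W"
proof -
  obtain T where T: "sub T" "T \<subseteq> W" "T \<inter> (U \<inter> W) = {\<zero>\<^bsub>V\<^esub>}" "T \<^bold>+ (U \<inter> W) = W"
    using sub_complement[OF W sub_Int[OF U W]] by auto
  have dW: "sdim W = sdim T + sdim (U \<inter> W)"
    using sdim_ssum_disjoint[OF T(1) sub_Int[OF U W] T(3)] T(4) by simp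
  have "U \<^bold>+ W = U \<^bold>+ T"
  proof
    have "W \<subseteq> U \<^bold>+ T"
    proof
      fix w assume "w \<in> W"
      then obtain t z where "t \<in> T" "z \<in> U" "w = t \<oplus>\<^bsub>V\<^esub> z"
        using T(4) by (metis mem_ssum Int_iff)
      moreover have "t \<oplus>\<^bsub>V\<^esub> z = z \<oplus>\<^bsub>V\<^esub> t" if "t \<in> T" "z \<in> U" for t z
        using that sub_mem_carrier[OF U] sub_mem_carrier[OF T(1)] by (intro M.a_comm)
      ultimately show "w \<in> U \<^bold>+ T"
        unfolding mem_ssum by blast
    qed
    then show "U \<^bold>+ W \<subseteq> U \<^bold>+ T"
      using in_sum_vs[OF U T(1)] by (intro ssum_least sub_ssum U T)
    show "U \<^bold>+ T \<subseteq> U \<^bold>+ W" using T by (intro ssum_mono) auto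
  qed
  moreover have "U \<inter> T = {\<zero>\<^bsub>V\<^esub>}" using T by blast
  ultimately show ?thesis using sdim_ssum_disjoint[OF U T(1)] dW by simp
qed

text \<open>This is the exact price of making a subspace of \<open>X\<close> disjoint from
  \<open>Z\<close>; the rounding below removes every unwanted intersection in this way.\<close>

lemma sub_complement_dim:
  assumes X: "sub X" and Z: "sub Z"
  obtains T where "sub T" "T \<subseteq> X" "T \<inter> Z = {\<zero>\<^bsub>V\<^esub>}" "sdim T + sdim (X \<inter> Z) = sdim X"
proof -
  obtain T where T: "sub T" "T \<subseteq> X" "T \<inter> (X \<inter> Z) = {\<zero>\<^bsub>V\<^esub>}" "T \<^bold>+ (X \<inter> Z) = X"
    using sub_complement[OF X sub_Int[OF X Z]] by auto
  have "sdim T + sdim (X \<inter> Z) = sdim X"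
    using sdim_ssum_disjoint[OF T(1) sub_Int[OF X Z] T(3)] T(4) by simp
  moreover have "T \<inter> Z = {\<zero>\<^bsub>V\<^esub>}" using T by blast
  ultimately show thesis using that T by blast
qed

lemma eq_add_iff_minus_eq:
  assumes "x \<in> carrier V" "y \<in> carrier V" "t \<in> carrier V"
  shows "x = t \<oplus>\<^bsub>V\<^esub> y \<longleftrightarrow> x \<ominus>\<^bsub>V\<^esub> y = t"
  unfolding a_minus_def using M.add.inv_solve_right[of t x y] assms by auto

lemma minus_eq_zero_iff:
  assumes "x \<in> carrier V" "y \<in> carrier V"
  shows "x \<ominus>\<^bsub>V\<^esub> y = \<zero>\<^bsub>V\<^esub> \<longleftrightarrow> x = y"
  using eq_add_iff_minus_eq[of x y "\<zero>\<^bsub>V\<^esub>"] assms by auto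

lemma minus_minus_cancel_left:
  assumes "x \<in> carrier V" "y \<in> carrier V" "z \<in> carrier V"
  shows "(x \<ominus>\<^bsub>V\<^esub> z) \<ominus>\<^bsub>V\<^esub> (x \<ominus>\<^bsub>V\<^esub> y) = y \<ominus>\<^bsub>V\<^esub> z"
  using assms by (simp add: a_minus_def M.minus_add M.a_ac M.r_neg1 M.r_neg2)

lemma uminus_minus:
  assumes "x \<in> carrier V" "y \<in> carrier V"
  shows "\<ominus>\<^bsub>V\<^esub> (x \<ominus>\<^bsub>V\<^esub> y) = y \<ominus>\<^bsub>V\<^esub> x"
  using assms by (simp add: a_minus_def M.minus_add M.a_ac)

lemma sdim_ssum_le: "sub U \<Longrightarrow> sub W \<Longrightarrow> sdim (U \<^bold>+ W) \<le> sdim U + sdim W"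
  using sdim_ssum_Int[of U W] by simp

lemma sdim_Int_ge:
  assumes "sub X" "sub U" "sub W" "U \<subseteq> X" "W \<subseteq> X"
  shows "sdim U + sdim W \<le> sdim (U \<inter> W) + sdim X"
  using sdim_ssum_Int[of U W] sdim_mono[OF sub_ssum[of U W] assms(1) ssum_least[of X U W]] assms by simp

text \<open>\<open>T\<close> meets \<open>Y\<close> trivially, so it is the graph of a partial
  linear map from \<open>X\<close> to \<open>Y\<close>, and (T + C) \<inter> X is the preimage of
  \<open>C\<close>. The bound holds because T + C is direct and T + C + X stays inside X +
  Y.\<close>

lemma sdim_correspondence_preimage:
  assumes "sub T" "sub C" "sub X" "sub Y" "C \<subseteq> Y" "T \<inter> Y = {\<zero>\<^bsub>V\<^esub>}" "T \<subseteq> X \<^bold>+ Y"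
  shows "sdim T + sdim C \<le> sdim ((T \<^bold>+ C) \<inter> X) + sdim Y"
proof -
  have "T \<inter> C = {\<zero>\<^bsub>V\<^esub>}" using assms sub_zero by blast
  then have 1: "sdim (T \<^bold>+ C) = sdim T + sdim C" using assms by (intro sdim_ssum_disjoint)
  have XY: "X \<subseteq> X \<^bold>+ Y" "Y \<subseteq> X \<^bold>+ Y"
    using in_sum_vs[of X Y] in_sum_vs[of Y X] vsum_comm[of X Y] assms by auto
  have "sdim (T \<^bold>+ C \<^bold>+ X) \<le> sdim (X \<^bold>+ Y)"
    using assms XY by (intro sdim_mono ssum_least sub_ssum) auto
  also have "\<dots> \<le> sdim X + sdim Y" using assms by (intro sdim_ssum_le)
  finally show ?thesis using 1 sdim_ssum_Int[of "T \<^bold>+ C" X] assms sub_ssum by simp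
qed

end

section \<open>Approximate actions of presented groups\<close>

text \<open>
  A generator \<open>s\<close> acts through \<open>T s i\<close>, read as the graph \<open>{(x, y). x - y \<in> T s i}\<close> of a partial
  isomorphism between \<open>B i\<close> and \<open>B (i + 1)\<close>. All indices are understood modulo 3.
\<close>

locale approx_rep = findim_vectorspace K V
  for K :: "('k, 'm) ring_scheme" and V :: "('k, 'v, 'n) module_scheme" +
  fixes S :: "'a set" and R :: "'a list set" and c :: nat
    and B :: "nat \<Rightarrow> 'v set" and T :: "'a \<Rightarrow> nat \<Rightarrow> 'v set" and \<delta> :: real
  assumes sub_B: "sub (B i)"
    and sub_T: "s \<in> S \<Longrightarrow> sub (T s i)"
    and B_mod: "B i = B (i mod 3)"
    and T_mod: "T s i = T s (i mod 3)"
    and B_indep: "x \<in> B i \<Longrightarrow> y \<in> B (i + 1) \<Longrightarrow> z \<in> B (i + 2) \<Longrightarrow>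
      x \<oplus>\<^bsub>V\<^esub> y \<oplus>\<^bsub>V\<^esub> z = \<zero>\<^bsub>V\<^esub> \<Longrightarrow> x = \<zero>\<^bsub>V\<^esub> \<and> y = \<zero>\<^bsub>V\<^esub> \<and> z = \<zero>\<^bsub>V\<^esub>"
    and T_le: "s \<in> S \<Longrightarrow> T s i \<subseteq> B i \<^bold>+ B (i + 1)"
    and T_Int_source: "s \<in> S \<Longrightarrow> T s i \<inter> B i = {\<zero>\<^bsub>V\<^esub>}"
    and T_Int_target: "s \<in> S \<Longrightarrow> T s i \<inter> B (i + 1) = {\<zero>\<^bsub>V\<^esub>}"
    and dim_B_ge: "(1 - \<delta>) * c \<le> sdim (B i)"
    and dim_B_le: "sdim (B i) \<le> (1 + \<delta>) * c"
    and dim_T_ge: "s \<in> S \<Longrightarrow> (1 - \<delta>) * c \<le> sdim (T s i)"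
    and dim_relator: "[s'', s', s] \<in> R \<Longrightarrow> s \<in> S \<Longrightarrow> s' \<in> S \<Longrightarrow> s'' \<in> S \<Longrightarrow>
      sdim (T s i \<^bold>+ T s' (i + 1) \<^bold>+ T s'' (i + 2)) \<le> (2 + \<delta>) * c"
begin

section \<open>Letters and words as partial isomorphisms\<close>

definition shift :: "bool \<Rightarrow> nat" where
  "shift b = (if b then 2 else 1)"

text \<open>\<open>T s j\<close> joins \<open>B j\<close> and \<open>B (j + 1)\<close>, so a
  positive letter going from \<open>i\<close> to \<open>i - 1\<close> uses the index
  \<open>i + 2\<close>. One subspace serves both directions because it is closed under
  negation.\<close>

definition graph :: "nat \<Rightarrow> 'a \<times> bool \<Rightarrow> 'v set" where
  "graph i l = T (fst l) (if snd l then i + 2 else i)"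

definition letter :: "nat \<Rightarrow> 'a \<times> bool \<Rightarrow> 'v \<Rightarrow> 'v \<Rightarrow> bool" where
  "letter i l x y \<longleftrightarrow> x \<in> B i \<and> y \<in> B (i + shift (snd l)) \<and> x \<ominus>\<^bsub>V\<^esub> y \<in> graph i l"

text \<open>
  Words act from the right and a positive letter lowers the index, \<open>i + 2\<close> standing for \<open>i - 1\<close>:
  this matches the order \<open>s'' s' s\<close> of the letters in the relator of the line \<open>{s\<^sub>i, s'\<^sub>j, s''\<^sub>k}\<close>.
\<close>

primrec word_rel :: "nat \<Rightarrow> ('a \<times> bool) list \<Rightarrow> 'v \<Rightarrow> 'v \<Rightarrow> bool" where
  "word_rel i [] x y \<longleftrightarrow> x \<in> B i \<and> y = x"
| "word_rel i (l # w) x z \<longleftrightarrow> (\<exists>y. letter i l x y \<and> word_rel (i + shift (snd l)) w y z)"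

definition word_shift :: "('a \<times> bool) list \<Rightarrow> nat" where
  "word_shift w = (\<Sum>l\<leftarrow>w. shift (snd l))"

lemma word_shift_simps [simp]:
  "word_shift [] = 0" "word_shift (l # w) = shift (snd l) + word_shift w"
  "word_shift (u @ w) = word_shift u + word_shift w"
  by (auto simp: word_shift_def)

lemma B_cong: "i mod 3 = j mod 3 \<Longrightarrow> B i = B j"
  by (metis B_mod)

lemma T_cong: "i mod 3 = j mod 3 \<Longrightarrow> T s i = T s j"
  by (metis T_mod)

lemma B_carrier: "x \<in> B i \<Longrightarrow> x \<in> carrier V"
  using sub_mem_carrier[OF sub_B] .

lemma letter_cong:
  assumes "i mod 3 = j mod 3"
  shows "letter i l = letter j l"
proof -
  have "(i + k) mod 3 = (j + k) mod 3" for k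
    using assms by (rule mod_add_cong) simp
  then have "B i = B j" "B (i + shift (snd l)) = B (j + shift (snd l))" "graph i l = graph j l"
    unfolding graph_def using assms by (auto intro!: B_cong T_cong simp del: add_2_eq_Suc')
  then show ?thesis
    by (simp add: letter_def fun_eq_iff)
qed

lemma word_rel_cong:
  assumes "i mod 3 = j mod 3"
  shows "word_rel i w = word_rel j w"
  using assms
proof (induction w arbitrary: i j)
  case Nil
  then show ?case using B_cong[of i j] by (auto simp: fun_eq_iff)
next
  case (Cons l w)
  have "(i + shift (snd l)) mod 3 = (j + shift (snd l)) mod 3"
    using Cons.prems by (rule mod_add_cong) simp
  from Cons.IH[OF this] letter_cong[OF Cons.prems] show ?case
    by (auto simp: fun_eq_iff)
qed

lemma graph_props:
  assumes "fst l \<in> S"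
  shows "sub (graph i l)" "graph i l \<subseteq> B i \<^bold>+ B (i + shift (snd l))"
    "graph i l \<inter> B (i + shift (snd l)) = {\<zero>\<^bsub>V\<^esub>}" "(1 - \<delta>) * c \<le> sdim (graph i l)"
proof -
  have "B (i + 3) = B i" by (rule B_cong) simp
  then have "T s (i + 2) \<subseteq> B i \<^bold>+ B (i + 2)" if "s \<in> S" for s
    using T_le[OF that, of "i + 2"] vsum_comm[OF sub_B sub_B, of i "i + 2"] by (simp add: eval_nat_numeral)
  then show "graph i l \<subseteq> B i \<^bold>+ B (i + shift (snd l))"
    using T_le[OF assms, of i] assms by (auto simp: graph_def shift_def)
  show "sub (graph i l)" "(1 - \<delta>) * c \<le> sdim (graph i l)"
    using assms sub_T dim_T_ge by (auto simp: graph_def)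
  show "graph i l \<inter> B (i + shift (snd l)) = {\<zero>\<^bsub>V\<^esub>}"
    using T_Int_source[OF assms] T_Int_target[OF assms] by (simp add: graph_def shift_def)
qed

text \<open>The difference of two images of \<open>x\<close> is a difference of two graph elements
  and lies in the target joint, which meets the graph only in zero.\<close>

lemma letter_unique:
  assumes "fst l \<in> S" "letter i l x y" "letter i l x z"
  shows "y = z"
proof -
  let ?X = "B (i + shift (snd l))"
  have c: "x \<in> carrier V" "y \<in> carrier V" "z \<in> carrier V"
    using assms B_carrier by (auto simp: letter_def)
  have "(x \<ominus>\<^bsub>V\<^esub> z) \<ominus>\<^bsub>V\<^esub> (x \<ominus>\<^bsub>V\<^esub> y) \<in> graph i l"
    using assms by (intro sub_minus[OF graph_props(1)[OF assms(1)], of "x \<ominus>\<^bsub>V\<^esub> z"]) (simp_all add: letter_def)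
  moreover have "y \<ominus>\<^bsub>V\<^esub> z \<in> ?X"
    using assms by (intro sub_minus[OF sub_B]) (simp_all add: letter_def)
  ultimately have "y \<ominus>\<^bsub>V\<^esub> z \<in> graph i l \<inter> ?X"
    using minus_minus_cancel_left[OF c] by simp
  then have "y \<ominus>\<^bsub>V\<^esub> z = \<zero>\<^bsub>V\<^esub>" using graph_props(3)[OF assms(1)] by blast
  then show ?thesis using c by (simp add: minus_eq_zero_iff)
qed

text \<open>Exchanging \<open>x\<close> and \<open>y\<close> negates their difference, and
  \<open>shift b + shift (\<not> b)\<close> is 3, so the inverse letter leads back to the original
  joint.\<close>

lemma letter_inverse:
  assumes "s \<in> S" "letter i (s, b) x y"
  shows "letter (i + shift b) (s, \<not> b) y x"
proof -
  have c: "x \<in> carrier V" "y \<in> carrier V"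
    using assms B_carrier by (auto simp: letter_def)
  have "\<ominus>\<^bsub>V\<^esub> (x \<ominus>\<^bsub>V\<^esub> y) \<in> graph i (s, b)"
    using assms by (intro sub_uminus[OF graph_props(1)]) (simp_all add: letter_def)
  then have "y \<ominus>\<^bsub>V\<^esub> x \<in> graph i (s, b)" using uminus_minus[OF c] by simp
  moreover have "graph i (s, b) = graph (i + shift b) (s, \<not> b)"
    unfolding graph_def shift_def fst_conv snd_conv by (rule T_cong) simp
  moreover have "B i = B (i + shift b + shift (\<not> b))"
    by (intro B_cong) (simp add: shift_def)
  ultimately show ?thesis using assms by (auto simp: letter_def)
qed

text \<open>The preimage is (graph + C) \<inter> B i. It loses at most the dimension of the target
  joint minus that of the graph, and each of these two differs from c by at most \<delta> c in the
  relevant direction.\<close>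

lemma letter_preimage:
  assumes "fst l \<in> S" "sub C" "C \<subseteq> B (i + shift (snd l))"
  shows "sub {x. \<exists>y\<in>C. letter i l x y}"
    and "sdim C - 2 * \<delta> * c \<le> sdim {x. \<exists>y\<in>C. letter i l x y}"
proof -
  have eq: "{x. \<exists>y\<in>C. letter i l x y} = (graph i l \<^bold>+ C) \<inter> B i"
  proof -
    have *: "x = t \<oplus>\<^bsub>V\<^esub> y \<longleftrightarrow> x \<ominus>\<^bsub>V\<^esub> y = t" if "x \<in> B i" "y \<in> C" "t \<in> graph i l" for x y t
      using that B_carrier sub_mem_carrier[OF assms(2)] sub_mem_carrier[OF graph_props(1)[OF assms(1)]]
      by (intro eq_add_iff_minus_eq)
    have "(\<exists>y\<in>C. letter i l x y) \<longleftrightarrow> x \<in> (graph i l \<^bold>+ C) \<inter> B i" for x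
    proof
      assume "\<exists>y\<in>C. letter i l x y"
      then obtain y where y: "y \<in> C" "x \<in> B i" "x \<ominus>\<^bsub>V\<^esub> y \<in> graph i l"
        by (auto simp: letter_def)
      then have "x = (x \<ominus>\<^bsub>V\<^esub> y) \<oplus>\<^bsub>V\<^esub> y" using * by blast
      then show "x \<in> (graph i l \<^bold>+ C) \<inter> B i" using y unfolding Int_iff mem_ssum by blast
    next
      assume "x \<in> (graph i l \<^bold>+ C) \<inter> B i"
      then obtain t y where "t \<in> graph i l" "y \<in> C" "x = t \<oplus>\<^bsub>V\<^esub> y" "x \<in> B i"
        unfolding Int_iff mem_ssum by blast
      then show "\<exists>y\<in>C. letter i l x y"
        using *[of x y t] assms(3) by (auto simp: letter_def intro!: bexI[of _ y])
    qed
    then show ?thesis by blast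
  qed
  show "sub {x. \<exists>y\<in>C. letter i l x y}"
    unfolding eq using assms by (intro sub_Int sub_ssum graph_props sub_B)
  have "sdim (graph i l) + sdim C \<le> sdim ((graph i l \<^bold>+ C) \<inter> B i) + sdim (B (i + shift (snd l)))"
    using assms by (intro sdim_correspondence_preimage graph_props sub_B)
  then show "sdim C - 2 * \<delta> * c \<le> sdim {x. \<exists>y\<in>C. letter i l x y}"
    unfolding eq using graph_props(4)[OF assms(1), of i] dim_B_le[of "i + shift (snd l)"]
    by (simp add: algebra_simps)
qed

lemma word_rel_mem: "word_rel i w x y \<Longrightarrow> x \<in> B i \<and> y \<in> B (i + word_shift w)"
  by (induction w arbitrary: i x) (fastforce simp: letter_def add.assoc)+

lemma word_rel_unique:
  "w \<in> words S \<Longrightarrow> word_rel i w x y \<Longrightarrow> word_rel i w x z \<Longrightarrow> y = z"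
  by (induction w arbitrary: i x) (auto dest: letter_unique)

lemma word_rel_append:
  "word_rel i (u @ w) x z \<longleftrightarrow> (\<exists>y. word_rel i u x y \<and> word_rel (i + word_shift u) w y z)"
proof (induction u arbitrary: i x)
  case Nil
  then show ?case using word_rel_mem[of i w] by auto
next
  case (Cons l u)
  then show ?case by (auto simp: ac_simps)
qed

section \<open>Agreement of words up to small codimension\<close>

definition preimage :: "nat \<Rightarrow> ('a \<times> bool) list \<Rightarrow> 'v set \<Rightarrow> 'v set" where
  "preimage i w C = {x. \<exists>y\<in>C. word_rel i w x y}"

lemma preimage_subset: "preimage i w C \<subseteq> B i"
  using word_rel_mem by (auto simp: preimage_def)

text \<open>Every letter costs at most 2 \<delta> c dimensions, by
  \<open>letter_preimage\<close>.\<close>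

lemma word_preimage:
  assumes "w \<in> words S" "sub C" "C \<subseteq> B (i + word_shift w)"
  shows "sub (preimage i w C) \<and> sdim C - 2 * length w * \<delta> * c \<le> sdim (preimage i w C)"
  using assms
proof (induction w arbitrary: i)
  case Nil
  then have "preimage i [] C = C" by (auto simp: preimage_def)
  then show ?case using Nil by simp
next
  case (Cons l w)
  let ?P = "preimage (i + shift (snd l)) w C"
  have IH: "sub ?P" "sdim C - 2 * length w * \<delta> * c \<le> sdim ?P"
    using Cons by (auto simp: ac_simps)
  have eq: "preimage i (l # w) C = {x. \<exists>y\<in>?P. letter i l x y}"
    by (auto simp: preimage_def)
  have l: "fst l \<in> S" using Cons.prems by simp
  show ?case
    unfolding eq using letter_preimage[OF l IH(1) preimage_subset] IH(2)
    by (simp add: algebra_simps)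
qed

text \<open>\<open>k\<close> counts the lost dimensions in units of \<delta> c. It may grow along a
  derivation, as long as it does not depend on the representation.\<close>

definition agree :: "nat \<Rightarrow> ('a \<times> bool) list \<Rightarrow> ('a \<times> bool) list \<Rightarrow> real \<Rightarrow> bool" where
  "agree i u v k \<longleftrightarrow> (\<exists>D. sub D \<and> D \<subseteq> B i \<and> (1 - k * \<delta>) * c \<le> sdim D \<and>
     (\<forall>x\<in>D. \<exists>y. word_rel i u x y \<and> word_rel i v x y))"

lemma agree_refl:
  assumes "w \<in> words S"
  shows "agree i w w (1 + 2 * real (length w))"
  unfolding agree_def
proof (intro exI conjI)
  \<comment> \<open>The domain of \<open>w\<close> loses 1 for the lower bound on the last joint and
    2 for each letter.\<close>
  let ?D = "preimage i w (B (i + word_shift w))"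
  show "sub ?D" "?D \<subseteq> B i" using word_preimage[OF assms sub_B] preimage_subset by auto
  show "(1 - (1 + 2 * real (length w)) * \<delta>) * c \<le> sdim ?D"
    using word_preimage[OF assms sub_B, of "i + word_shift w" i] dim_B_ge[of "i + word_shift w"]
    by (simp add: algebra_simps)
  show "\<forall>x\<in>?D. \<exists>y. word_rel i w x y \<and> word_rel i w x y"
    by (auto simp: preimage_def)
qed

lemma agree_sym: "agree i u v k \<Longrightarrow> agree i v u k"
  unfolding agree_def by blast

text \<open>The two losses add up; the extra 1 pays for the possible excess of
  \<open>sdim (B i)\<close> over \<open>c\<close>.\<close>

lemma dim_Int_in_B:
  assumes "sub D" "D \<subseteq> B i" "sub E" "E \<subseteq> B i"
    and "(1 - k * \<delta>) * c \<le> sdim D" "(1 - l * \<delta>) * c \<le> sdim E"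
  shows "(1 - (k + l + 1) * \<delta>) * c \<le> sdim (D \<inter> E)"
  using sdim_Int_ge[OF sub_B assms(1,3,2,4)] assms(5,6) dim_B_le[of i]
  by (simp add: algebra_simps)

text \<open>On the intersection of the two domains the value of \<open>v\<close> is unique, hence is
  the value shared by all three words.\<close>

lemma agree_trans:
  assumes "v \<in> words S" "agree i u v k" "agree i v w l"
  shows "agree i u w (k + l + 1)"
proof -
  obtain D where D: "sub D" "D \<subseteq> B i" "(1 - k * \<delta>) * c \<le> sdim D"
    "\<forall>x\<in>D. \<exists>y. word_rel i u x y \<and> word_rel i v x y"
    using assms(2) unfolding agree_def by blast
  obtain E where E: "sub E" "E \<subseteq> B i" "(1 - l * \<delta>) * c \<le> sdim E"
    "\<forall>x\<in>E. \<exists>y. word_rel i v x y \<and> word_rel i w x y"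
    using assms(3) unfolding agree_def by blast
  have "\<exists>y. word_rel i u x y \<and> word_rel i w x y" if "x \<in> D \<inter> E" for x
    using that D(4) E(4) word_rel_unique[OF assms(1)] by (metis Int_iff)
  then show ?thesis
    unfolding agree_def
    using sub_Int[OF D(1) E(1)] D(2) dim_Int_in_B[OF D(1,2) E(1,2) D(3) E(3)] by blast
qed

text \<open>Domains are pulled back from right to left: \<open>E\<close> is where \<open>v\<close>
  is defined, \<open>F\<close> is what \<open>a\<close> sends into \<open>E\<close>, and
  \<open>G\<close> is what \<open>u\<close> sends into D \<inter> F. The condition on shifts makes
  \<open>v\<close> start at the same joint after \<open>a\<close> and after
  \<open>b\<close>.\<close>

lemma agree_context:
  assumes w: "u \<in> words S" "a \<in> words S" "v \<in> words S"
    and sh: "word_shift a mod 3 = word_shift b mod 3"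
    and ag: "agree (i + word_shift u) a b k"
  shows "agree i (u @ a @ v) (u @ b @ v) (k + 2 + 2 * length u + 2 * length a + 2 * length v)"
proof -
  let ?j = "i + word_shift u"
  let ?m = "?j + word_shift a"
  obtain D where D: "sub D" "D \<subseteq> B ?j" "(1 - k * \<delta>) * c \<le> sdim D"
    "\<forall>x\<in>D. \<exists>y. word_rel ?j a x y \<and> word_rel ?j b x y"
    using ag unfolding agree_def by blast
  define E where "E = preimage ?m v (B (?m + word_shift v))"
  have E: "sub E" "E \<subseteq> B ?m" "(1 - \<delta>) * c - 2 * length v * \<delta> * c \<le> sdim E"
    using word_preimage[OF w(3) sub_B, of "?m + word_shift v" ?m] preimage_subset dim_B_ge[of "?m + word_shift v"]
    by (auto simp: E_def)
  define F where "F = preimage ?j a E"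
  have F: "sub F" "F \<subseteq> B ?j" "(1 - (1 + 2 * length a + 2 * length v) * \<delta>) * c \<le> sdim F"
    using word_preimage[OF w(2) E(1,2)] preimage_subset E(3)
    by (auto simp: F_def algebra_simps)
  define G where "G = preimage i u (D \<inter> F)"
  have DF: "sub (D \<inter> F)" "D \<inter> F \<subseteq> B ?j" using sub_Int D F by auto
  \<comment> \<open>\<open>D\<close> loses \<open>k\<close>, \<open>F\<close> loses 1 for the last
    joint and 2 per letter of \<open>a\<close> and \<open>v\<close>, and the intersection loses 1
    more. Pulling back along \<open>u\<close> then adds 2 per letter of \<open>u\<close>.\<close>
  have "(1 - (k + (1 + 2 * length a + 2 * length v) + 1) * \<delta>) * c \<le> sdim (D \<inter> F)"
    by (rule dim_Int_in_B[OF D(1,2) F(1,2) D(3) F(3)])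
  then have G: "sub G" "G \<subseteq> B i"
    "(1 - (k + 2 + 2 * length u + 2 * length a + 2 * length v) * \<delta>) * c \<le> sdim G"
    using word_preimage[OF w(1) DF] preimage_subset by (auto simp: G_def algebra_simps)
  have "(?j + word_shift b) mod 3 = ?m mod 3"
    using sh by (intro mod_add_cong) auto
  then have eq: "word_rel (?j + word_shift b) v = word_rel ?m v"
    by (rule word_rel_cong)
  have "\<exists>z. word_rel i (u @ a @ v) x z \<and> word_rel i (u @ b @ v) x z" if x: "x \<in> G" for x
  proof -
    obtain y where y: "y \<in> D" "y \<in> F" "word_rel i u x y"
      using x by (auto simp: G_def preimage_def)
    obtain z where z: "word_rel ?j a y z" "word_rel ?j b y z" using D(4) y by blast
    obtain z' where z': "z' \<in> E" "word_rel ?j a y z'" using y(2) by (auto simp: F_def preimage_def)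
    \<comment> \<open>\<open>D\<close> supplies a common value of \<open>a\<close> and
      \<open>b\<close>, and \<open>F\<close> a value of \<open>a\<close> from which \<open>v\<close>
      continues; uniqueness identifies the two.\<close>
    have "z' = z" by (rule word_rel_unique[OF w(2) z'(2) z(1)])
    then obtain t where "word_rel ?m v z t" using z'(1) by (auto simp: E_def preimage_def)
    then show ?thesis using y(3) z eq by (auto simp: word_rel_append)
  qed
  then show ?thesis unfolding agree_def using G by blast
qed

text \<open>On the domain of the first letter, going out and back is the identity. That domain loses
  2, and the lower bound on the joint loses 1.\<close>

lemma agree_cancel:
  assumes "s \<in> S"
  shows "agree i [(s, b), (s, \<not> b)] [] 3"
proof -
  let ?D = "{x. \<exists>y\<in>B (i + shift b). letter i (s, b) x y}"
  have "sub ?D" "sdim (B (i + shift b)) - 2 * \<delta> * c \<le> sdim ?D"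
    using letter_preimage[of "(s, b)" "B (i + shift b)" i] sub_B assms by auto
  moreover have "?D \<subseteq> B i" by (auto simp: letter_def)
  moreover have "\<exists>y. word_rel i [(s, b), (s, \<not> b)] x y \<and> word_rel i [] x y" if x: "x \<in> ?D" for x
  proof -
    obtain y where y: "letter i (s, b) x y" using x by blast
    have "B (i + shift b + shift (\<not> b)) = B i"
      by (intro B_cong) (simp add: shift_def)
    then show ?thesis using y letter_inverse[OF assms y] by (auto simp: letter_def)
  qed
  ultimately show ?thesis
    unfolding agree_def using dim_B_ge[of "i + shift b"]
    by (intro exI[of _ ?D]) (auto simp: algebra_simps)
qed

section \<open>Relators and equal generators\<close>

lemma B_sum_unique:
  assumes "x \<in> B i" "x' \<in> B i" "y \<in> B (i + 1)" "z \<in> B (i + 2)"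
    and "x = x' \<oplus>\<^bsub>V\<^esub> y \<oplus>\<^bsub>V\<^esub> z"
  shows "x = x'" "y = \<zero>\<^bsub>V\<^esub>" "z = \<zero>\<^bsub>V\<^esub>"
proof -
  have c: "x \<in> carrier V" "x' \<in> carrier V" "y \<in> carrier V" "z \<in> carrier V"
    using assms B_carrier by auto
  have "(x' \<ominus>\<^bsub>V\<^esub> x) \<oplus>\<^bsub>V\<^esub> y \<oplus>\<^bsub>V\<^esub> z = (x' \<oplus>\<^bsub>V\<^esub> y \<oplus>\<^bsub>V\<^esub> z) \<ominus>\<^bsub>V\<^esub> x"
    using c by (simp add: a_minus_def M.a_ac)
  also have "\<dots> = \<zero>\<^bsub>V\<^esub>" using c assms(5) by simp
  finally have *: "(x' \<ominus>\<^bsub>V\<^esub> x) \<oplus>\<^bsub>V\<^esub> y \<oplus>\<^bsub>V\<^esub> z = \<zero>\<^bsub>V\<^esub>" .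
  have "x' \<ominus>\<^bsub>V\<^esub> x \<in> B i" using assms by (intro sub_minus sub_B)
  note 0 = B_indep[OF this assms(3,4) *]
  then show "y = \<zero>\<^bsub>V\<^esub>" "z = \<zero>\<^bsub>V\<^esub>" by auto
  show "x = x'" using 0 c by (simp add: minus_eq_zero_iff)
qed

lemma T_decompose:
  assumes "s \<in> S" "t \<in> T s i"
  obtains x y where "x \<in> B i" "y \<in> B (i + 1)" "t = x \<oplus>\<^bsub>V\<^esub> y"
  using subsetD[OF T_le[OF assms(1)] assms(2)] unfolding mem_ssum by blast

text \<open>Independence of the joints makes the first two graphs independent, so with the third the
  dimensions add up to at least 3 (1 - \<delta>) c. The sum has dimension at most (2 + \<delta>) c,
  which leaves an overlap of (1 - 4 \<delta>) c.\<close>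

lemma relator_dim:
  assumes "[s'', s', s] \<in> R" "s \<in> S" "s' \<in> S" "s'' \<in> S"
  shows "(1 - 4 * \<delta>) * c \<le> sdim ((T s i \<^bold>+ T s' (i + 1)) \<inter> T s'' (i + 2))"
proof -
  have "T s i \<inter> T s' (i + 1) \<subseteq> {\<zero>\<^bsub>V\<^esub>}"
  proof
    fix t assume t: "t \<in> T s i \<inter> T s' (i + 1)"
    obtain x y where xy: "x \<in> B i" "y \<in> B (i + 1)" "t = x \<oplus>\<^bsub>V\<^esub> y"
      using T_decompose[OF assms(2)] t by blast
    obtain y' z where yz: "y' \<in> B (i + 1)" "z \<in> B (i + 2)" "t = y' \<oplus>\<^bsub>V\<^esub> z"
      using T_decompose[OF assms(3), of t "i + 1"] t by auto
    have c: "x \<in> carrier V" "y \<in> carrier V" "y' \<in> carrier V" "z \<in> carrier V"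
      using xy yz B_carrier by auto
    \<comment> \<open>The two decompositions of \<open>t\<close> share only the joint
      \<open>B (i + 1)\<close>. Comparing them kills the component in \<open>B i\<close>, so
      \<open>t\<close> lies in the target of the first graph.\<close>
    have "x \<oplus>\<^bsub>V\<^esub> (y \<ominus>\<^bsub>V\<^esub> y') \<oplus>\<^bsub>V\<^esub> (\<ominus>\<^bsub>V\<^esub> z) = (x \<oplus>\<^bsub>V\<^esub> y) \<ominus>\<^bsub>V\<^esub> (y' \<oplus>\<^bsub>V\<^esub> z)"
      using c by (simp add: a_minus_def M.minus_add M.a_ac)
    also have "\<dots> = \<zero>\<^bsub>V\<^esub>" using c xy yz minus_eq_zero_iff[of t t] by simp
    finally have "x = \<zero>\<^bsub>V\<^esub>"
      using B_indep[of x i "y \<ominus>\<^bsub>V\<^esub> y'" "\<ominus>\<^bsub>V\<^esub> z"] xy yz sub_minus[OF sub_B] sub_uminus[OF sub_B] by blast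
    then have "t \<in> B (i + 1)" using xy c by simp
    then show "t \<in> {\<zero>\<^bsub>V\<^esub>}" using T_Int_target[OF assms(2), of i] t by blast
  qed
  then have "T s i \<inter> T s' (i + 1) = {\<zero>\<^bsub>V\<^esub>}"
    using sub_zero[OF sub_T] assms by blast
  then have 1: "sdim (T s i \<^bold>+ T s' (i + 1)) = sdim (T s i) + sdim (T s' (i + 1))"
    using assms by (intro sdim_ssum_disjoint sub_T)
  have "sdim (T s i \<^bold>+ T s' (i + 1) \<^bold>+ T s'' (i + 2)) + sdim ((T s i \<^bold>+ T s' (i + 1)) \<inter> T s'' (i + 2))
      = sdim (T s i \<^bold>+ T s' (i + 1)) + sdim (T s'' (i + 2))"
    using assms by (intro sdim_ssum_Int sub_ssum sub_T)
  then show ?thesis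
    using 1 dim_relator[OF assms, of i] dim_T_ge[OF assms(2), of i] dim_T_ge[OF assms(3), of "i + 1"]
      dim_T_ge[OF assms(4), of "i + 2"]
    by (simp add: algebra_simps)
qed

text \<open>The overlap \<open>U\<close> is part of the composite of the graphs of \<open>s\<close>
  and \<open>s'\<close> and also of the graph of \<open>s''\<close>. On its domain \<open>D\<close>
  in \<open>B i\<close>, the three edges therefore form a closed path around the triangle.\<close>

lemma agree_relator:
  assumes R: "[s'', s', s] \<in> R" and S: "s \<in> S" "s' \<in> S" "s'' \<in> S"
  shows "agree i (pos_word [s'', s', s]) [] 4"
proof -
  have per: "B (i + 3) = B i" "B (i + 2 + 2) = B (i + 1)" "B (i + 2 + 2 + 2) = B i"
    "T s (i + 2 + 2 + 2) = T s i" "T s' (i + 2 + 2) = T s' (i + 1)"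
    by (rule B_cong T_cong, presburger)+
  define U where "U = (T s i \<^bold>+ T s' (i + 1)) \<inter> T s'' (i + 2)"
  have sU: "sub U" using S by (auto simp: U_def intro!: sub_Int sub_ssum sub_T)
  have U_le: "U \<subseteq> B i \<^bold>+ B (i + 2)"
    using T_le[OF S(3), of "i + 2"] per vsum_comm[OF sub_B sub_B, of i "i + 2"]
    by (auto simp: U_def eval_nat_numeral)
  have U_Int: "U \<inter> B (i + 2) = {\<zero>\<^bsub>V\<^esub>}"
    using T_Int_source[OF S(3), of "i + 2"] sub_zero[OF sU] by (auto simp: U_def)
  define D where "D = (U \<^bold>+ B (i + 2)) \<inter> B i"
  have sD: "sub D" by (auto simp: D_def intro!: sub_Int sub_ssum sU sub_B)
  \<comment> \<open>Here \<open>C\<close> is the whole target joint, so passing from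
    \<open>U\<close> to its domain loses no dimension.\<close>
  have "sdim U + sdim (B (i + 2)) \<le> sdim D + sdim (B (i + 2))"
    unfolding D_def using sU U_le U_Int by (intro sdim_correspondence_preimage sub_B) auto
  then have dD: "(1 - 4 * \<delta>) * c \<le> sdim D"
    using relator_dim[OF assms, of i] by (simp add: U_def)
  have "word_rel i (pos_word [s'', s', s]) x x" if x: "x \<in> D" for x
  proof -
    have xB: "x \<in> B i" using x by (simp add: D_def)
    obtain u z where uz: "u \<in> U" "z \<in> B (i + 2)" "x = u \<oplus>\<^bsub>V\<^esub> z"
      using x by (auto simp: D_def mem_ssum)
    obtain t t' where t: "t \<in> T s i" "t' \<in> T s' (i + 1)" "u = t \<oplus>\<^bsub>V\<^esub> t'"
      using uz by (auto simp: U_def mem_ssum)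
    obtain a b where ab: "a \<in> B i" "b \<in> B (i + 1)" "t = a \<oplus>\<^bsub>V\<^esub> b"
      using T_decompose[OF S(1) t(1)] .
    obtain b' d where bd: "b' \<in> B (i + 1)" "d \<in> B (i + 2)" "t' = b' \<oplus>\<^bsub>V\<^esub> d"
      using T_decompose[OF S(2) t(2)] by auto
    have c: "a \<in> carrier V" "b \<in> carrier V" "b' \<in> carrier V" "d \<in> carrier V" "z \<in> carrier V"
      "x \<in> carrier V" "u \<in> carrier V"
      using ab bd uz B_carrier sub_mem_carrier[OF sU] xB by auto
    \<comment> \<open>Comparing components in the three joints gives a = x, b' = -b and d = -z. The
      closed path is x, z, y, x with y = -b.\<close>
    have "x = a \<oplus>\<^bsub>V\<^esub> (b \<oplus>\<^bsub>V\<^esub> b') \<oplus>\<^bsub>V\<^esub> (d \<oplus>\<^bsub>V\<^esub> z)"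
      using c unfolding uz(3) t(3) ab(3) bd(3) by (simp add: M.a_ac)
    note 0 = B_sum_unique[OF xB ab(1) sub_add[OF sub_B ab(2) bd(1)] sub_add[OF sub_B bd(2) uz(2)] this]
    define y where "y = \<ominus>\<^bsub>V\<^esub> b"
    have yB: "y \<in> B (i + 1)" using ab sub_uminus[OF sub_B] by (simp add: y_def)
    have b': "y = b'" using 0(2) c by (metis y_def M.minus_equality M.a_comm)
    have d: "\<ominus>\<^bsub>V\<^esub> z = d" using 0(3) c by (metis M.minus_equality)
    have 1: "x \<ominus>\<^bsub>V\<^esub> y \<in> T s i"
      using t(1) ab(3) 0(1) c by (simp add: y_def a_minus_def)
    have 2: "y \<ominus>\<^bsub>V\<^esub> z \<in> T s' (i + 1)"
      using t(2) bd(3) b' d by (simp add: a_minus_def)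
    have "x \<ominus>\<^bsub>V\<^esub> z = u" using eq_add_iff_minus_eq[of x z u] uz(3) c by simp
    then have 3: "x \<ominus>\<^bsub>V\<^esub> z \<in> T s'' (i + 2)"
      using uz(1) by (simp add: U_def)
    have c': "y \<in> carrier V" using yB B_carrier by simp
    have l1: "letter i (s'', True) x z"
      using xB uz(2) 3 by (simp add: letter_def graph_def shift_def)
    have "z \<ominus>\<^bsub>V\<^esub> y \<in> T s' (i + 1)" "y \<ominus>\<^bsub>V\<^esub> x \<in> T s i"
      using sub_uminus[OF sub_T[OF S(2)] 2] sub_uminus[OF sub_T[OF S(1)] 1]
        uminus_minus c c' by auto
    then have l2: "letter (i + 2) (s', True) z y" and l3: "letter (i + 2 + 2) (s, True) y x"
      unfolding letter_def graph_def shift_def fst_conv snd_conv if_True per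
      using uz(2) yB xB by auto
    show ?thesis
      unfolding pos_word_def list.map word_rel.simps shift_def snd_conv if_True per
      using l1 l2 l3 xB by blast
  qed
  then show ?thesis
    unfolding agree_def using sD dD by (intro exI[of _ D]) (auto simp: D_def)
qed

text \<open>A common value y of both letters at x puts x - y into both graphs. So \<open>D\<close>
  lies in the domain of the graph \<open>?U\<close>, and since \<open>B (i + 2)\<close> and
  \<open>B i\<close> are independent, that domain is no larger than \<open>?U\<close>.\<close>

lemma agree_generators:
  assumes S: "s \<in> S" "s' \<in> S" and ag: "agree i [(s, True)] [(s', True)] k"
  shows "(1 - k * \<delta>) * c \<le> sdim (T s (i + 2) \<inter> T s' (i + 2))"
proof -
  have per: "B (i + 3) = B i" by (intro B_cong) simp
  obtain D where D: "sub D" "D \<subseteq> B i" "(1 - k * \<delta>) * c \<le> sdim D"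
    "\<forall>x\<in>D. \<exists>y. word_rel i [(s, True)] x y \<and> word_rel i [(s', True)] x y"
    using ag unfolding agree_def by blast
  let ?U = "T s (i + 2) \<inter> T s' (i + 2)"
  have sU: "sub ?U" using S by (intro sub_Int sub_T)
  have "D \<subseteq> (?U \<^bold>+ B (i + 2)) \<inter> B i"
  proof
    fix x assume x: "x \<in> D"
    then obtain y where y: "x \<in> B i" "y \<in> B (i + 2)" "x \<ominus>\<^bsub>V\<^esub> y \<in> ?U"
      using D(4) by (fastforce simp: letter_def graph_def shift_def)
    then have "x = (x \<ominus>\<^bsub>V\<^esub> y) \<oplus>\<^bsub>V\<^esub> y"
      using eq_add_iff_minus_eq[of x y "x \<ominus>\<^bsub>V\<^esub> y"] B_carrier by simp
    then show "x \<in> (?U \<^bold>+ B (i + 2)) \<inter> B i" using y by (auto simp: mem_ssum)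
  qed
  then have 1: "sdim D \<le> sdim ((?U \<^bold>+ B (i + 2)) \<inter> B i)"
    by (intro sdim_mono sub_Int sub_ssum sU sub_B D)
  have "B (i + 2) \<inter> B i \<subseteq> {\<zero>\<^bsub>V\<^esub>}"
  proof
    fix x assume x: "x \<in> B (i + 2) \<inter> B i"
    have "x \<oplus>\<^bsub>V\<^esub> \<zero>\<^bsub>V\<^esub> \<oplus>\<^bsub>V\<^esub> (\<ominus>\<^bsub>V\<^esub> x) = \<zero>\<^bsub>V\<^esub>"
      using B_carrier[of x i] x M.r_neg by simp
    then show "x \<in> {\<zero>\<^bsub>V\<^esub>}"
      using B_indep[of x i "\<zero>\<^bsub>V\<^esub>" "\<ominus>\<^bsub>V\<^esub> x"] x sub_zero[OF sub_B] sub_uminus[OF sub_B] by auto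
  qed
  then have "B (i + 2) \<inter> B i = {\<zero>\<^bsub>V\<^esub>}" using sub_zero[OF sub_B] by blast
  then have 2: "sdim (B (i + 2) \<^bold>+ B i) = sdim (B (i + 2)) + sdim (B i)"
    by (intro sdim_ssum_disjoint sub_B)
  \<comment> \<open>The modular law bounds the domain: adding \<open>?U\<close> to
    \<open>B (i + 2)\<close> gains at most \<open>sdim ?U\<close>, while the sum with
    \<open>B i\<close> is at least as large as the direct sum of the two joints.\<close>
  have "B (i + 2) \<subseteq> ?U \<^bold>+ B (i + 2)"
    using in_sum_vs[OF sub_B sU] vsum_comm[OF sub_B sU] by auto
  then have "sdim (B (i + 2) \<^bold>+ B i) \<le> sdim (?U \<^bold>+ B (i + 2) \<^bold>+ B i)"
    by (intro sdim_mono sub_ssum ssum_mono sU sub_B) auto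
  moreover have "sdim (?U \<^bold>+ B (i + 2) \<^bold>+ B i) + sdim ((?U \<^bold>+ B (i + 2)) \<inter> B i)
      = sdim (?U \<^bold>+ B (i + 2)) + sdim (B i)"
    by (intro sdim_ssum_Int sub_ssum sU sub_B)
  moreover have "sdim (?U \<^bold>+ B (i + 2)) \<le> sdim ?U + sdim (B (i + 2))"
    by (intro sdim_ssum_le sU sub_B)
  ultimately have "sdim ((?U \<^bold>+ B (i + 2)) \<inter> B i) \<le> sdim ?U" using 2 by linarith
  with 1 D(3) show ?thesis by linarith
qed

end

section \<open>Uniform constants along derivations\<close>

text \<open>Each rule of the derivation has its own estimate. Quantifying \<open>k\<close> before
  the field, the space, the scale and \<delta> allows \<epsilon> to be chosen in terms of
  \<open>k\<close> afterwards, which is why the statement is outside the locale.\<close>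

lemma pres_eq_imp_agree:
  assumes "pres_eq S R u v" and R3: "\<forall>r\<in>R. length r = 3"
  shows "\<exists>k\<ge>0. \<forall>(K :: ('k, 'm) ring_scheme) (V :: ('k, 'v, 'n) module_scheme) c B T \<delta> i.
    approx_rep K V S R c B T \<delta> \<longrightarrow> approx_rep.agree K V c B T \<delta> i u v k"
  using assms(1)
proof (induction rule: pres_eq.induct)
  case (refl w)
  then show ?case
    using approx_rep.agree_refl by (intro exI[of _ "1 + 2 * real (length w)"] conjI) (simp, blast)
next
  case (sym u v)
  then show ?case by (meson approx_rep.agree_sym)
next
  case (trans u v w)
  obtain k where k: "k \<ge> 0" "\<And>(K :: ('k, 'm) ring_scheme) (V :: ('k, 'v, 'n) module_scheme) c B T \<delta> i.
    approx_rep K V S R c B T \<delta> \<Longrightarrow> approx_rep.agree K V c B T \<delta> i u v k" using trans.IH(1) by blast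
  obtain l where l: "l \<ge> 0" "\<And>(K :: ('k, 'm) ring_scheme) (V :: ('k, 'v, 'n) module_scheme) c B T \<delta> i.
    approx_rep K V S R c B T \<delta> \<Longrightarrow> approx_rep.agree K V c B T \<delta> i v w l" using trans.IH(2) by blast
  have v: "v \<in> words S" using pres_eq_words[OF trans.hyps(1)] by simp
  show ?case
    using k(1) l(1) approx_rep.agree_trans[OF _ v k(2) l(2)]
    by (intro exI[of _ "k + l + 1"] conjI allI impI) simp_all
next
  case (cancel u s b v)
  then have w: "u \<in> words S" "[(s, b), (s, \<not> b)] \<in> words S" "v \<in> words S" "s \<in> S" by auto
  let ?k = "3 + 2 + 2 * real (length u) + 2 * real (length [(s, b), (s, \<not> b)]) + 2 * real (length v)"
  have "approx_rep.agree K V c B T \<delta> i (u @ [(s, b), (s, \<not> b)] @ v) (u @ v) ?k"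
    if "approx_rep K V S R c B T \<delta>"
    for K :: "('k, 'm) ring_scheme" and V :: "('k, 'v, 'n) module_scheme" and c B T \<delta> i
  proof -
    interpret approx_rep K V S R c B T \<delta> by fact
    have "word_shift [(s, b), (s, \<not> b)] mod 3 = word_shift [] mod 3"
      by (simp add: shift_def)
    from agree_context[OF w(1-3) this agree_cancel[OF w(4)]] show ?thesis by simp
  qed
  then show ?case by (intro exI[of _ ?k]) auto
next
  case (relator r u v)
  then have "length r = 3" using R3 by blast
  then obtain s'' s' s where r: "r = [s'', s', s]"
    by (auto simp: length_Suc_conv eval_nat_numeral)
  have w: "u \<in> words S" "pos_word r \<in> words S" "v \<in> words S" using relator by auto
  then have S: "s \<in> S" "s' \<in> S" "s'' \<in> S" by (auto simp: r pos_word_def)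
  let ?k = "4 + 2 + 2 * real (length u) + 2 * real (length (pos_word r)) + 2 * real (length v)"
  have "approx_rep.agree K V c B T \<delta> i (u @ pos_word r @ v) (u @ v) ?k"
    if "approx_rep K V S R c B T \<delta>"
    for K :: "('k, 'm) ring_scheme" and V :: "('k, 'v, 'n) module_scheme" and c B T \<delta> i
  proof -
    interpret approx_rep K V S R c B T \<delta> by fact
    \<comment> \<open>Three positive letters shift by 6, so \<open>v\<close> starts at the same
      joint with and without the relator.\<close>
    have "word_shift (pos_word r) mod 3 = word_shift [] mod 3"
      by (simp add: r pos_word_def shift_def)
    from agree_context[OF w this agree_relator[OF relator.hyps(1)[unfolded r] S, folded r]]
    show ?thesis by simp
  qed
  then show ?case by (intro exI[of _ ?k]) auto
qed

section \<open>Dowling geometries\<close>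

text \<open>Joints become independent by passing successively to complements. Each
  \<open>P s i\<close> is then cut down to the sum of its two joints and away from either of them;
  subspaces only shrink, so upper bounds survive.\<close>

lemma (in findim_vectorspace) ex_approx_rep:
  fixes S :: "'a set" and J :: "nat \<Rightarrow> 'v set" and P :: "'a \<Rightarrow> nat \<Rightarrow> 'v set" and c :: nat and \<epsilon> :: real
  assumes \<epsilon>: "\<epsilon> \<ge> 0"
    and subJ: "\<And>i. sub (J i)" and subP: "\<And>s i. s \<in> S \<Longrightarrow> sub (P s i)"
    and J_mod: "\<And>i. J i = J (i mod 3)" and P_mod: "\<And>s i. P s i = P s (i mod 3)"
    and J_ge: "\<And>i. (1 - \<epsilon>) * c \<le> sdim (J i)" and J_le: "\<And>i. sdim (J i) \<le> (1 + \<epsilon>) * c"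
    and JJ_ge: "\<And>i. (2 - \<epsilon>) * c \<le> sdim (J i \<^bold>+ J (i + 1))"
    and JJ_le: "\<And>i. sdim (J i \<^bold>+ J (i + 1)) \<le> (2 + \<epsilon>) * c"
    and JJJ_ge: "(3 - \<epsilon>) * c \<le> sdim (J 0 \<^bold>+ J 1 \<^bold>+ J 2)"
    and P_ge: "\<And>s i. s \<in> S \<Longrightarrow> (1 - \<epsilon>) * c \<le> sdim (P s i)"
    and P_le: "\<And>s i. s \<in> S \<Longrightarrow> sdim (P s i) \<le> (1 + \<epsilon>) * c"
    and PJ_ge: "\<And>s i. s \<in> S \<Longrightarrow> (2 - \<epsilon>) * c \<le> sdim (P s i \<^bold>+ J i)"
      "\<And>s i. s \<in> S \<Longrightarrow> (2 - \<epsilon>) * c \<le> sdim (P s i \<^bold>+ J (i + 1))"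
    and PJJ_le: "\<And>s i. s \<in> S \<Longrightarrow> sdim (P s i \<^bold>+ (J i \<^bold>+ J (i + 1))) \<le> (2 + \<epsilon>) * c"
    and PPP_le: "\<And>s s' s'' i. [s'', s', s] \<in> R \<Longrightarrow> s \<in> S \<Longrightarrow> s' \<in> S \<Longrightarrow> s'' \<in> S \<Longrightarrow>
      sdim (P s i \<^bold>+ P s' (i + 1) \<^bold>+ P s'' (i + 2)) \<le> (2 + \<epsilon>) * c"
  obtains B T where "approx_rep K V S R c B T (16 * \<epsilon>)" "\<And>s i. s \<in> S \<Longrightarrow> T s i \<subseteq> P s i"
proof -
  have \<epsilon>c: "\<epsilon> * c \<ge> 0" using \<epsilon> by simp
  obtain B1 where B1: "sub B1" "B1 \<subseteq> J 1" "B1 \<inter> J 0 = {\<zero>\<^bsub>V\<^esub>}"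
    "sdim B1 + sdim (J 1 \<inter> J 0) = sdim (J 1)"
    using sub_complement_dim[OF subJ subJ] by blast
  have sJJ: "sub (J 0 \<^bold>+ J 1)" by (intro sub_ssum subJ)
  obtain B2 where B2: "sub B2" "B2 \<subseteq> J 2" "B2 \<inter> (J 0 \<^bold>+ J 1) = {\<zero>\<^bsub>V\<^esub>}"
    "sdim B2 + sdim (J 2 \<inter> (J 0 \<^bold>+ J 1)) = sdim (J 2)"
    using sub_complement_dim[OF subJ sJJ] by blast
  \<comment> \<open>By the modular law \<open>sdim B1\<close> is the dimension of J 0 + J 1 minus
    that of \<open>J 0\<close>, hence at least (1 - 2 \<epsilon>) c; the 4 is slack. The bound for
    \<open>B2\<close> is similar.\<close>
  have B1_ge: "(1 - 4 * \<epsilon>) * c \<le> sdim B1"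
    using B1(4) sdim_ssum_Int[OF subJ subJ, of 0 1] JJ_ge[of 0] J_le[of 0] \<epsilon>c
    by (simp add: Int_commute algebra_simps)
  have B2_ge: "(1 - 4 * \<epsilon>) * c \<le> sdim B2"
    using B2(4) sdim_ssum_Int[OF sJJ subJ, of 2] JJ_le[of 0] JJJ_ge \<epsilon>c
    by (simp add: Int_commute algebra_simps)
  define B where "B i = (if i mod 3 = 0 then J 0 else if i mod 3 = 1 then B1 else B2)" for i :: nat
  have m3: "i mod 3 = 0 \<or> i mod 3 = 1 \<or> i mod 3 = 2" for i :: nat by linarith
  have B_mod: "B i = B (i mod 3)" for i by (simp add: B_def)
  have B_cong: "B i = B j" if "i mod 3 = j mod 3" for i j using B_mod that by metis
  have J_cong: "J i = J j" if "i mod 3 = j mod 3" for i j using J_mod that by metis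
  have P_cong: "P s i = P s j" if "i mod 3 = j mod 3" for s i j using P_mod that by metis
  have subB: "sub (B i)" for i using subJ B1 B2 by (simp add: B_def)
  have BJ: "B i \<subseteq> J i" for i
  proof -
    have "B (i mod 3) \<subseteq> J (i mod 3)" using m3[of i] B1 B2 by (auto simp: B_def)
    then show ?thesis using B_mod J_mod by metis
  qed
  have B_ge: "(1 - 4 * \<epsilon>) * c \<le> sdim (B i)" for i
    using m3[of i] B1_ge B2_ge J_ge[of 0] \<epsilon>c by (auto simp: B_def algebra_simps)
  have B_le: "sdim (B i) \<le> (1 + \<epsilon>) * c" for i
    using sdim_mono[OF subB subJ BJ, of i] J_le[of i] by linarith
  have indep0: "x = \<zero>\<^bsub>V\<^esub> \<and> y = \<zero>\<^bsub>V\<^esub> \<and> z = \<zero>\<^bsub>V\<^esub>"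
    if xyz: "x \<in> J 0" "y \<in> B1" "z \<in> B2" "x \<oplus>\<^bsub>V\<^esub> y \<oplus>\<^bsub>V\<^esub> z = \<zero>\<^bsub>V\<^esub>" for x y z
  proof -
    have cc: "x \<in> carrier V" "y \<in> carrier V" "z \<in> carrier V"
      using sub_mem_carrier[OF subJ xyz(1)] sub_mem_carrier[OF B1(1) xyz(2)] sub_mem_carrier[OF B2(1) xyz(3)]
      by simp_all
    have xy: "x \<oplus>\<^bsub>V\<^esub> y \<in> J 0 \<^bold>+ J 1" using xyz B1(2) unfolding mem_ssum by blast
    have "x \<oplus>\<^bsub>V\<^esub> y = \<ominus>\<^bsub>V\<^esub> z" using xyz(4) cc M.minus_equality[of "x \<oplus>\<^bsub>V\<^esub> y" z] by simp
    then have "x \<oplus>\<^bsub>V\<^esub> y \<in> B2" using sub_uminus[OF B2(1) xyz(3)] by simp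
    then have 1: "x \<oplus>\<^bsub>V\<^esub> y = \<zero>\<^bsub>V\<^esub>" using xy B2(3) by blast
    then have z: "z = \<zero>\<^bsub>V\<^esub>" using xyz(4) cc by simp
    have "x = \<ominus>\<^bsub>V\<^esub> y" using 1 cc M.minus_equality[of x y] by simp
    then have "x \<in> B1" using sub_uminus[OF B1(1) xyz(2)] by simp
    then have x: "x = \<zero>\<^bsub>V\<^esub>" using xyz B1(3) by blast
    then have "y = \<zero>\<^bsub>V\<^esub>" using 1 cc by simp
    with x z show ?thesis by simp
  qed
  have indep: "x = \<zero>\<^bsub>V\<^esub> \<and> y = \<zero>\<^bsub>V\<^esub> \<and> z = \<zero>\<^bsub>V\<^esub>"
    if xyz: "x \<in> B i" "y \<in> B (i + 1)" "z \<in> B (i + 2)" "x \<oplus>\<^bsub>V\<^esub> y \<oplus>\<^bsub>V\<^esub> z = \<zero>\<^bsub>V\<^esub>" for x y z i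
  proof -
    have cc: "x \<in> carrier V" "y \<in> carrier V" "z \<in> carrier V"
      using sub_mem_carrier[OF subB xyz(1)] sub_mem_carrier[OF subB xyz(2)] sub_mem_carrier[OF subB xyz(3)]
      by simp_all
    \<comment> \<open>Rotating the three summands reduces each case to
      \<open>indep0\<close>.\<close>
    consider "i mod 3 = 0" | "i mod 3 = 1" | "i mod 3 = 2" using m3[of i] by satx
    then show ?thesis
    proof cases
      case 1
      then have "(i + 1) mod 3 = 1" "(i + 2) mod 3 = 2" by presburger+
      then show ?thesis using 1 xyz indep0 unfolding B_def by simp
    next
      case 2
      then have "(i + 1) mod 3 = 2" "(i + 2) mod 3 = 0" by presburger+
      then have "x \<in> B1" "y \<in> B2" "z \<in> J 0" using xyz 2 unfolding B_def by simp_all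
      moreover have "z \<oplus>\<^bsub>V\<^esub> x \<oplus>\<^bsub>V\<^esub> y = \<zero>\<^bsub>V\<^esub>" using xyz(4) cc by (simp add: M.a_ac)
      ultimately show ?thesis using indep0 by blast
    next
      case 3
      then have "(i + 1) mod 3 = 0" "(i + 2) mod 3 = 1" by presburger+
      then have "x \<in> B2" "y \<in> J 0" "z \<in> B1" using xyz 3 unfolding B_def by simp_all
      moreover have "y \<oplus>\<^bsub>V\<^esub> z \<oplus>\<^bsub>V\<^esub> x = \<zero>\<^bsub>V\<^esub>" using xyz(4) cc by (simp add: M.a_ac)
      ultimately show ?thesis using indep0 by blast
    qed
  qed
  have BB: "B i \<inter> B (i + 1) = {\<zero>\<^bsub>V\<^esub>}" for i
  proof -
    have "x = \<zero>\<^bsub>V\<^esub>" if x: "x \<in> B i" "x \<in> B (i + 1)" for x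
    proof -
      have "x \<oplus>\<^bsub>V\<^esub> (\<ominus>\<^bsub>V\<^esub> x) \<oplus>\<^bsub>V\<^esub> \<zero>\<^bsub>V\<^esub> = \<zero>\<^bsub>V\<^esub>"
        using sub_mem_carrier[OF subB x(1)] M.r_neg by simp
      then show ?thesis
        using indep[OF x(1) sub_uminus[OF subB x(2)] sub_zero[OF subB]] by blast
    qed
    then show ?thesis using sub_zero[OF subB] by blast
  qed
  define Q where "Q s i X \<longleftrightarrow> sub X \<and> X \<subseteq> P s i \<and> X \<subseteq> B i \<^bold>+ B (i + 1) \<and> X \<inter> B i = {\<zero>\<^bsub>V\<^esub>} \<and>
    X \<inter> B (i + 1) = {\<zero>\<^bsub>V\<^esub>} \<and> (1 - 16 * \<epsilon>) * c \<le> sdim X" for s i X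
  \<comment> \<open>The predicate depends on \<open>i\<close> only modulo 3, so the choice of
    \<open>T\<close> by \<open>SOME\<close> is periodic too.\<close>
  have Q_cong: "Q s i = Q s j" if "i mod 3 = j mod 3" for s i j
  proof -
    have "(i + 1) mod 3 = (j + 1) mod 3" using that by (rule mod_add_cong) simp
    then have "B (i + 1) = B (j + 1)" by (rule B_cong)
    then show ?thesis
      unfolding Q_def fun_eq_iff using B_cong[OF that] P_cong[OF that] by metis
  qed
  have Q_ex: "\<exists>X. Q s i X" if s: "s \<in> S" for s i
  proof -
    let ?BB = "B i \<^bold>+ B (i + 1)"
    have sBB: "sub ?BB" by (intro sub_ssum subB)
    let ?X = "P s i \<inter> ?BB"
    have sX: "sub ?X" by (intro sub_Int subP s sBB)
    have "sdim (P s i \<^bold>+ ?BB) \<le> sdim (P s i \<^bold>+ (J i \<^bold>+ J (i + 1)))"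
      by (intro sdim_mono sub_ssum subP s sBB subJ ssum_mono BJ subB) auto
    \<comment> \<open>(1 - \<epsilon>) + 2 (1 - 4 \<epsilon>) - (2 + \<epsilon>) = 1 - 10
      \<epsilon>.\<close>
    then have X: "(1 - 10 * \<epsilon>) * c \<le> sdim ?X"
      using sdim_ssum_Int[OF subP[OF s, of i] sBB] sdim_ssum_disjoint[OF subB subB BB, of i]
        B_ge[of i] B_ge[of "i + 1"] P_ge[OF s, of i] PJJ_le[OF s, of i]
      by (simp add: algebra_simps)
    have "sdim (?X \<inter> B i) \<le> sdim (P s i \<inter> J i)"
      using BJ by (intro sdim_mono sub_Int sX subB subP subJ s) auto
    \<comment> \<open>2 (1 + \<epsilon>) - (2 - \<epsilon>) = 3 \<epsilon>. Avoiding each of the two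
      joints costs this much, and 10 + 3 + 3 = 16.\<close>
    then have X1: "sdim (?X \<inter> B i) \<le> 3 * \<epsilon> * c"
      using sdim_ssum_Int[OF subP[OF s] subJ, of i i] PJ_ge(1)[OF s, of i] P_le[OF s, of i] J_le[of i]
      by (simp add: algebra_simps)
    obtain Y where Y: "sub Y" "Y \<subseteq> ?X" "Y \<inter> B i = {\<zero>\<^bsub>V\<^esub>}" "sdim Y + sdim (?X \<inter> B i) = sdim ?X"
      using sub_complement_dim[OF sX subB] by blast
    have "sdim (Y \<inter> B (i + 1)) \<le> sdim (P s i \<inter> J (i + 1))"
    proof (intro sdim_mono sub_Int Y subB subP subJ s)
      show "Y \<inter> B (i + 1) \<subseteq> P s i \<inter> J (i + 1)" using Y(2) BJ[of "i + 1"] by blast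
    qed
    then have Y1: "sdim (Y \<inter> B (i + 1)) \<le> 3 * \<epsilon> * c"
      using sdim_ssum_Int[OF subP[OF s] subJ, of i "i + 1"] PJ_ge(2)[OF s, of i] P_le[OF s, of i] J_le[of "i + 1"]
      by (simp add: algebra_simps)
    obtain Z where Z: "sub Z" "Z \<subseteq> Y" "Z \<inter> B (i + 1) = {\<zero>\<^bsub>V\<^esub>}" "sdim Z + sdim (Y \<inter> B (i + 1)) = sdim Y"
      using sub_complement_dim[OF Y(1) subB] by blast
    have "Z \<inter> B i = {\<zero>\<^bsub>V\<^esub>}" using Z(2) Y(3) sub_zero[OF Z(1)] sub_zero[OF subB, of i] by blast
    moreover have "(1 - 16 * \<epsilon>) * c \<le> sdim Z" using X X1 Y(4) Y1 Z(4) by (simp add: algebra_simps)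
    ultimately show ?thesis unfolding Q_def using Z Y(2) by blast
  qed
  define T where "T s i = (SOME X. Q s i X)" for s i
  have Q: "Q s i (T s i)" if "s \<in> S" for s i
    unfolding T_def by (rule someI_ex[OF Q_ex[OF that]])
  have T: "sub (T s i)" "T s i \<subseteq> B i \<^bold>+ B (i + 1)" "T s i \<inter> B i = {\<zero>\<^bsub>V\<^esub>}"
    "T s i \<inter> B (i + 1) = {\<zero>\<^bsub>V\<^esub>}" "(1 - 16 * \<epsilon>) * c \<le> sdim (T s i)" "T s i \<subseteq> P s i"
    if "s \<in> S" for s i
    using Q[OF that, of i] unfolding Q_def by blast+
  have T_mod: "T s i = T s (i mod 3)" for s i
    unfolding T_def by (subst Q_cong[of i "i mod 3"]) simp_all
  have B_ge': "(1 - 16 * \<epsilon>) * c \<le> sdim (B i)" for i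
    using B_ge[of i] \<epsilon>c by (simp add: algebra_simps)
  have B_le': "sdim (B i) \<le> (1 + 16 * \<epsilon>) * c" for i
    using B_le[of i] \<epsilon>c by (simp add: algebra_simps)
  have TTT: "sdim (T s i \<^bold>+ T s' (i + 1) \<^bold>+ T s'' (i + 2)) \<le> (2 + 16 * \<epsilon>) * c"
    if r: "[s'', s', s] \<in> R" "s \<in> S" "s' \<in> S" "s'' \<in> S" for s s' s'' i
  proof -
    have "sdim (T s i \<^bold>+ T s' (i + 1) \<^bold>+ T s'' (i + 2)) \<le> sdim (P s i \<^bold>+ P s' (i + 1) \<^bold>+ P s'' (i + 2))"
      using r by (intro sdim_mono sub_ssum ssum_mono T subP)
    then show ?thesis using PPP_le[OF r, of i] \<epsilon>c by (simp add: algebra_simps)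
  qed
  have "approx_rep K V S R c B T (16 * \<epsilon>)"
    by (intro approx_rep.intro approx_rep_axioms.intro findim_vectorspace_axioms;
        (rule subB B_mod T_mod indep T(1-5) B_ge' B_le' TTT; assumption))
  then show thesis using that T(6) by blast
qed

section \<open>Ranks in the Dowling geometry\<close>

lemma matroid_rank_indep:
  assumes "finite A" "indep A"
  shows "matroid_rank indep A = card A"
  unfolding matroid_rank_def
proof (rule Max_eqI)
  show "finite (card ` {X. X \<subseteq> A \<and> indep X})" using assms by simp
  show "card A \<in> card ` {X. X \<subseteq> A \<and> indep X}" using assms by blast
  show "n \<le> card A" if "n \<in> card ` {X. X \<subseteq> A \<and> indep X}" for n
    using that card_mono[OF assms(1)] by blast
qed

lemma dowling_rank_pair:
  assumes "A \<subseteq> dowling_ground S" "finite A" "card A \<le> 2"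
  shows "matroid_rank (dowling_indep S R) A = card A"
  using assms by (intro matroid_rank_indep) (auto simp: dowling_indep_def)

lemma dowling_rank_line:
  assumes "finite A" "A \<subseteq> L" "L \<in> dowling_lines S R"
  shows "matroid_rank (dowling_indep S R) A \<le> 2"
proof -
  let ?I = "{X. X \<subseteq> A \<and> dowling_indep S R X}"
  have "{} \<in> ?I" by (simp add: dowling_indep_def)
  then have "card ` ?I \<noteq> {}" by blast
  moreover have "card X \<le> 2" if "X \<in> ?I" for X
    using that assms(2,3) unfolding dowling_indep_def by blast
  ultimately show ?thesis
    unfolding matroid_rank_def using assms(1) by (subst Max_le_iff) auto
qed

lemma dowling_rank_joints:
  fixes S :: "'a set"
  shows "matroid_rank (dowling_indep S R) {Joint 1, Joint 2, Joint 3} = 3"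
proof -
  have "\<not> {Joint 1, Joint 2, Joint 3} \<subseteq> L" if "L \<in> dowling_lines S R" for L
    using that unfolding dowling_lines_def Un_iff insert_iff empty_iff mem_Collect_eq
    by (elim disjE exE conjE) simp_all
  moreover have "card {Joint 1, Joint 2, Joint 3 :: 'a dowling_point} = 3" by simp
  moreover have "{Joint 1, Joint 2, Joint 3} \<subseteq> dowling_ground S"
    unfolding dowling_ground_def by (rule Un_upper1)
  ultimately have "dowling_indep S R {Joint 1, Joint 2, Joint 3}"
    unfolding dowling_indep_def by blast
  then show ?thesis by (subst matroid_rank_indep) simp_all
qed

section \<open>From almost multilinearity to an approximate action\<close>

lemma (in vectorspace) subspace_in_subspace:
  assumes "subspace K U V" "subspace K X V" "U \<subseteq> X"
  shows "subspace K U (vs X)"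
  using assms subspace_is_vs[OF assms(2)] submodule_is_module[of X]
  by (auto simp: subspace_def submodule_def)

text \<open>The ambient space is replaced by the span of all \<open>W x\<close>, which has finite
  dimension even if \<open>V\<close> does not. Multiplying by \<open>c\<close> clears the
  denominator.\<close>

lemma almost_multilinearE:
  fixes \<epsilon> :: real
  assumes am: "almost_multilinear TYPE('k) TYPE('v) E indep" and \<epsilon>: "\<epsilon> > 0"
  obtains K :: "'k ring" and V :: "('k, 'v) module" and W and c :: nat where
    "findim_vectorspace K V" "c > 0" "\<And>x. x \<in> E \<Longrightarrow> subspace K (W x) V"
    "\<And>A. A \<subseteq> E \<Longrightarrow>
      \<bar>real (matroid_rank indep A) * c -
        findim_vectorspace.sdim K V (LinearCombinations.module.span K V (\<Union>x\<in>A. W x))\<bar> \<le> \<epsilon> * c"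
proof -
  have fE: "finite E" using am by (simp add: almost_multilinear_def matroid_def)
  obtain K :: "'k ring" and V :: "('k, 'v) module" and W and c :: nat
    where c: "c > 0" and vs: "vectorspace K V" and W: "\<forall>x\<in>E. subspace K (W x) V"
      and fd: "\<forall>A\<subseteq>E. vectorspace.fin_dim K (sum_subspaces K V W A)"
      and mx: "(MAX A\<in>Pow E. \<bar>real (matroid_rank indep A) -
            real (vectorspace.dim K (sum_subspaces K V W A)) / real c\<bar>) < \<epsilon>"
    using am \<epsilon> unfolding almost_multilinear_def by blast
  interpret V: vectorspace K V by (rule vs)
  define X where "X = V.span (\<Union>x\<in>E. W x)"
  have Wc: "(\<Union>x\<in>E. W x) \<subseteq> carrier V" using W by (auto simp: subspace_def submodule_def)
  have sX: "subspace K X V" unfolding X_def by (rule V.span_is_subspace[OF Wc])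
  have WX: "(\<Union>x\<in>E. W x) \<subseteq> X" unfolding X_def by (rule V.in_own_span[OF Wc])
  have "vectorspace K (V.vs X)" by (rule V.subspace_is_vs[OF sX])
  moreover have "vectorspace.fin_dim K (V.vs X)"
    using fd by (auto simp: sum_subspaces_def X_def)
  ultimately have fdX: "findim_vectorspace K (V.vs X)"
    by (simp add: findim_vectorspace_def findim_vectorspace_axioms_def)
  show thesis
  proof (rule that[OF fdX c])
    show "subspace K (W x) (V.vs X)" if "x \<in> E" for x
      using W WX that sX by (intro V.subspace_in_subspace) auto
    fix A assume A: "A \<subseteq> E"
    have "(\<Union>x\<in>A. W x) \<subseteq> X" using A WX by blast
    then have sp: "LinearCombinations.module.span K (V.vs X) (\<Union>x\<in>A. W x) = V.span (\<Union>x\<in>A. W x)"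
      using V.span_li_not_depend(1) sX by (simp add: subspace_def)
    have "\<bar>real (matroid_rank indep A) - real (vectorspace.dim K (sum_subspaces K V W A)) / real c\<bar> < \<epsilon>"
      using mx A fE by (subst (asm) Max_less_iff) auto
    also have "vectorspace.dim K (sum_subspaces K V W A) =
        findim_vectorspace.sdim K (V.vs X) (LinearCombinations.module.span K (V.vs X) (\<Union>x\<in>A. W x))"
      unfolding sp findim_vectorspace.sdim_def[OF fdX] by (simp add: sum_subspaces_def)
    finally have "\<bar>real (matroid_rank indep A) - real (findim_vectorspace.sdim K (V.vs X)
        (LinearCombinations.module.span K (V.vs X) (\<Union>x\<in>A. W x))) / real c\<bar> * c \<le> \<epsilon> * c"
      (is "\<bar>?r - ?d / _\<bar> * _ \<le> _") using c by (intro mult_right_mono) auto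
    moreover have "\<bar>?r - ?d / c\<bar> * c = \<bar>?r * c - ?d\<bar>"
      using c by (simp add: abs_mult_pos[symmetric] field_simps)
    ultimately show "\<bar>?r * c - ?d\<bar> \<le> \<epsilon> * c" by simp
  qed
qed

text \<open>The ranks of pairs, lines and the three joints are the input of the rounding. Distinct
  points have rank 2 together, so their subspaces, and the graphs inside them, overlap in at most 2
  (1 + \<epsilon>) c - (2 - \<epsilon>) c = 3 \<epsilon> c.\<close>

lemma (in findim_vectorspace) ex_dowling_approx_rep:
  fixes S :: "'a set" and W :: "'a dowling_point \<Rightarrow> 'v set" and c :: nat and \<epsilon> :: real
  assumes \<epsilon>: "\<epsilon> \<ge> 0" and W: "\<And>x. x \<in> dowling_ground S \<Longrightarrow> sub (W x)"
    and rk: "\<And>A. A \<subseteq> dowling_ground S \<Longrightarrow>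
      \<bar>real (matroid_rank (dowling_indep S R) A) * c - sdim (span (\<Union>x\<in>A. W x))\<bar> \<le> \<epsilon> * c"
  obtains B T where "approx_rep K V S R c B T (16 * \<epsilon>)"
    "\<And>s s' i. s \<in> S \<Longrightarrow> s' \<in> S \<Longrightarrow> s \<noteq> s' \<Longrightarrow> sdim (T s i \<inter> T s' i) \<le> 3 * \<epsilon> * c"
proof -
  let ?E = "dowling_ground S" and ?r = "matroid_rank (dowling_indep S R)"
  have sp1: "span (\<Union>x\<in>{a}. W x) = W a" if "a \<in> ?E" for a
    using span_sub[OF W[OF that]] by simp
  have sp2: "span (\<Union>x\<in>{a, b}. W x) = W a \<^bold>+ W b" if "a \<in> ?E" "b \<in> ?E" for a b
    using span_union_is_sum[of "W a" "W b"] span_sub sub_carrier W that by simp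
  have sp3: "span (\<Union>x\<in>{a, b, d}. W x) = W a \<^bold>+ (W b \<^bold>+ W d)" if "a \<in> ?E" "b \<in> ?E" "d \<in> ?E" for a b d
    using span_union_is_sum[of "W a" "W b \<union> W d"] span_union_is_sum[of "W b" "W d"] span_sub sub_carrier W that
    by simp
  have rank1: "(1 - \<epsilon>) * c \<le> sdim (W a)" "sdim (W a) \<le> (1 + \<epsilon>) * c" if a: "a \<in> ?E" for a
    using rk[of "{a}"] a sp1[OF a] dowling_rank_pair[of "{a}" S R] by (auto simp: algebra_simps abs_le_iff)
  have rank2: "(2 - \<epsilon>) * c \<le> sdim (W a \<^bold>+ W b)" "sdim (W a \<^bold>+ W b) \<le> (2 + \<epsilon>) * c"
    if ab: "a \<in> ?E" "b \<in> ?E" "a \<noteq> b" for a b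
    using rk[of "{a, b}"] ab sp2[OF ab(1,2)] dowling_rank_pair[of "{a, b}" S R]
    by (auto simp: algebra_simps abs_le_iff)
  have rank_line: "sdim (W a \<^bold>+ (W b \<^bold>+ W d)) \<le> (2 + \<epsilon>) * c"
    if abd: "a \<in> ?E" "b \<in> ?E" "d \<in> ?E" and L: "{a, b, d} \<subseteq> L" "L \<in> dowling_lines S R" for a b d L
  proof -
    have "real (?r {a, b, d}) * c \<le> 2 * real c"
      using dowling_rank_line[OF _ L] by (intro mult_right_mono) simp_all
    then show ?thesis
      using rk[of "{a, b, d}"] abd sp3[OF abd] by (auto simp: algebra_simps abs_le_iff)
  qed
  \<comment> \<open>Both sides are the span of the union of the three subspaces.\<close>
  have assoc: "W a \<^bold>+ W b \<^bold>+ W d = W a \<^bold>+ (W b \<^bold>+ W d)" if abd: "a \<in> ?E" "b \<in> ?E" "d \<in> ?E" for a b d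
    using span_union_is_sum[of "W a \<union> W b" "W d"] span_union_is_sum[of "W a" "W b"] span_sub sub_carrier W abd
      sp3[OF abd] by (simp add: Un_assoc)
  \<comment> \<open>Indices modulo 3 start at 0, whereas joints and points are numbered from
    1.\<close>
  define J where "J i = W (Joint (i mod 3 + 1))" for i
  define P where "P t i = W (Point t (i mod 3 + 1))" for t i
  have m3: "i mod 3 = 0 \<or> i mod 3 = 1 \<or> i mod 3 = 2" for i :: nat by linarith
  have JE: "Joint (i mod 3 + 1) \<in> ?E" for i using m3[of i] by (auto simp: dowling_ground_def)
  have PE: "Point t (i mod 3 + 1) \<in> ?E" if "t \<in> S" for t i
    using m3[of i] that by (auto simp: dowling_ground_def)
  have step: "i mod 3 \<noteq> (i + 1) mod 3" for i :: nat by presburger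
  obtain B T where rep: "approx_rep K V S R c B T (16 * \<epsilon>)" and TP: "\<And>t i. t \<in> S \<Longrightarrow> T t i \<subseteq> P t i"
  proof (rule ex_approx_rep[of \<epsilon> J S P c R])
    show "\<epsilon> \<ge> 0" by (rule \<epsilon>)
    show "J i = J (i mod 3)" "P t i = P t (i mod 3)" for t i by (simp_all add: J_def P_def)
    show "sub (J i)" "(1 - \<epsilon>) * c \<le> sdim (J i)" "sdim (J i) \<le> (1 + \<epsilon>) * c" for i
      unfolding J_def by (rule W rank1, rule JE)+
    show "sub (P t i)" "(1 - \<epsilon>) * c \<le> sdim (P t i)" "sdim (P t i) \<le> (1 + \<epsilon>) * c" if "t \<in> S" for t i
      unfolding P_def by (rule W rank1, rule PE[OF that])+
    show "(2 - \<epsilon>) * c \<le> sdim (J i \<^bold>+ J (i + 1))" "sdim (J i \<^bold>+ J (i + 1)) \<le> (2 + \<epsilon>) * c" for i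
      unfolding J_def using step[of i] by (auto intro!: rank2 JE simp del: One_nat_def add_Suc_right)
    show "(3 - \<epsilon>) * c \<le> sdim (J 0 \<^bold>+ J 1 \<^bold>+ J 2)"
    proof -
      have E: "Joint 1 \<in> ?E" "Joint 2 \<in> ?E" "Joint 3 \<in> ?E" by (auto simp: dowling_ground_def)
      have J: "J 0 = W (Joint 1)" "J 1 = W (Joint 2)" "J 2 = W (Joint 3)"
        unfolding J_def by (rule arg_cong[where f = "\<lambda>n. W (Joint n)"], simp)+
      have "J 0 \<^bold>+ J 1 \<^bold>+ J 2 = W (Joint 1) \<^bold>+ W (Joint 2) \<^bold>+ W (Joint 3)"
        unfolding J ..
      also have "\<dots> = span (\<Union>x\<in>{Joint 1, Joint 2, Joint 3}. W x)"
        unfolding assoc[OF E] sp3[OF E] ..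
      finally show ?thesis
        using rk[of "{Joint 1, Joint 2, Joint 3}"] E dowling_rank_joints[of S R]
        by (simp add: algebra_simps abs_le_iff)
    qed
    fix t i assume t: "t \<in> S"
    show "(2 - \<epsilon>) * c \<le> sdim (P t i \<^bold>+ J i)" "(2 - \<epsilon>) * c \<le> sdim (P t i \<^bold>+ J (i + 1))"
      unfolding J_def P_def by (rule rank2, rule PE[OF t], rule JE, simp)+
    show "sdim (P t i \<^bold>+ (J i \<^bold>+ J (i + 1))) \<le> (2 + \<epsilon>) * c"
    proof -
      \<comment> \<open>These three points lie on one side of the triangle of joints.\<close>
      have "\<exists>L\<in>dowling_lines S R.
        {Point t (i mod 3 + 1), Joint (i mod 3 + 1), Joint ((i + 1) mod 3 + 1)} \<subseteq> L"
      proof -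
        have "(i mod 3 + 1, (i + 1) mod 3 + 1) \<in> {(1, 2), (2, 3), (3, 1 :: nat)}"
          unfolding insert_iff prod.inject empty_iff by presburger
        moreover have "\<exists>L\<in>dowling_lines S R. {Point t a, Joint a, Joint b} \<subseteq> L"
          if "(a, b) \<in> {(1, 2), (2, 3), (3, 1)}" for a b
          using that t by (auto simp: dowling_lines_def)
        ultimately show ?thesis by simp
      qed
      then show ?thesis unfolding J_def P_def using rank_line[OF PE[OF t] JE JE] by blast
    qed
  next
    fix t t' t'' i assume t: "[t'', t', t] \<in> R" "t \<in> S" "t' \<in> S" "t'' \<in> S"
    have "\<exists>L\<in>dowling_lines S R.
      {Point t (i mod 3 + 1), Point t' ((i + 1) mod 3 + 1), Point t'' ((i + 2) mod 3 + 1)} \<subseteq> L"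
    proof -
      \<comment> \<open>Three consecutive indices form a cyclic shift of (1, 2, 3), as the relator
        lines require.\<close>
      have "(i mod 3 + 1, (i + 1) mod 3 + 1, (i + 2) mod 3 + 1) \<in> {(1, 2, 3), (2, 3, 1), (3, 1, 2 :: nat)}"
        unfolding insert_iff prod.inject empty_iff by presburger
      moreover have "{Point t a, Point t' b, Point t'' d} \<in> dowling_lines S R"
        if "(a, b, d) \<in> {(1, 2, 3), (2, 3, 1), (3, 1, 2)}" for a b d
        unfolding dowling_lines_def Un_iff mem_Collect_eq
        by (rule disjI2, rule exI[of _ t], rule exI[of _ t'], rule exI[of _ t''])
          (use t(1) that in auto)
      ultimately show ?thesis by (meson order_refl)
    qed
    then show "sdim (P t i \<^bold>+ P t' (i + 1) \<^bold>+ P t'' (i + 2)) \<le> (2 + \<epsilon>) * c"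
      unfolding P_def using rank_line[OF PE[OF t(2)] PE[OF t(3)] PE[OF t(4)]]
        assoc[OF PE[OF t(2)] PE[OF t(3)] PE[OF t(4)]] by metis
  qed blast
  show thesis
  proof (rule that[OF rep])
    fix s s' i assume s: "s \<in> S" and s': "s' \<in> S" and ne: "s \<noteq> s'"
    have subP: "sub (P t i)" if "t \<in> S" for t unfolding P_def by (rule W, rule PE[OF that])
    have "sdim (T s i \<inter> T s' i) \<le> sdim (P s i \<inter> P s' i)"
      using approx_rep.sub_T[OF rep] TP s s' by (intro sdim_mono sub_Int Int_mono subP) auto
    also have "sdim (P s i \<inter> P s' i) \<le> 3 * \<epsilon> * c"
      using sdim_ssum_Int[OF subP[OF s] subP[OF s']] rank1(2)[OF PE[OF s], of i]
        rank1(2)[OF PE[OF s'], of i] rank2(1)[OF PE[OF s, of i] PE[OF s', of i]] ne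
      by (simp add: P_def algebra_simps)
    finally show "sdim (T s i \<inter> T s' i) \<le> 3 * \<epsilon> * c" by simp
  qed
qed

section \<open>Choice of \<epsilon> and the contradiction\<close>

theorem theorem9p9:
  fixes S :: "'a set" and R :: "'a list set" and e :: 'a and iv :: "'a \<Rightarrow> 'a"
  assumes "symmetric_triangular S R e iv"
    and "almost_multilinear TYPE('k) TYPE('v) (dowling_ground S) (dowling_indep S R)"
  shows "\<forall>s\<in>S. \<forall>s'\<in>S. s \<noteq> s' \<longrightarrow> pres_gen S R s \<noteq> pres_gen S R s'"
proof (intro ballI impI notI)
  fix s s' assume s: "s \<in> S" and s': "s' \<in> S" and ne: "s \<noteq> s'"
    and "pres_gen S R s = pres_gen S R s'"
  then have eq: "pres_eq S R [(s, True)] [(s', True)]"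
    by (simp add: pres_gen_def class_eq_iff)
  have "\<forall>r\<in>R. length r = 3" using assms(1) by (simp add: symmetric_triangular_def)
  from pres_eq_imp_agree[OF eq this] obtain k where k: "k \<ge> 0"
    and agree: "\<And>(K :: 'k ring) (V :: ('k, 'v) module) c B T \<delta> i.
      approx_rep K V S R c B T \<delta> \<Longrightarrow> approx_rep.agree K V c B T \<delta> i [(s, True)] [(s', True)] k"
    by blast
  \<comment> \<open>This makes (16 k + 3) \<epsilon> equal to 1/2, while the estimates force it to
    be at least 1: the 16 comes from the rounding, the 3 from the overlap of distinct
    points.\<close>
  define \<epsilon> where "\<epsilon> = 1 / (2 * (16 * k + 3))"
  have \<epsilon>: "\<epsilon> > 0" using k by (simp add: \<epsilon>_def)
  let ?E = "dowling_ground S" and ?r = "matroid_rank (dowling_indep S R)"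
  obtain K :: "'k ring" and V :: "('k, 'v) module" and W and c :: nat where
    fdV: "findim_vectorspace K V" and c: "c > 0" and W: "\<And>x. x \<in> ?E \<Longrightarrow> subspace K (W x) V" and
    rk: "\<And>A. A \<subseteq> ?E \<Longrightarrow> \<bar>real (?r A) * c -
        findim_vectorspace.sdim K V (LinearCombinations.module.span K V (\<Union>x\<in>A. W x))\<bar> \<le> \<epsilon> * c"
    using almost_multilinearE[OF assms(2) \<epsilon>] by metis
  interpret findim_vectorspace K V by (rule fdV)
  obtain B T where rep: "approx_rep K V S R c B T (16 * \<epsilon>)"
    and T: "\<And>s s' i. s \<in> S \<Longrightarrow> s' \<in> S \<Longrightarrow> s \<noteq> s' \<Longrightarrow> sdim (T s i \<inter> T s' i) \<le> 3 * \<epsilon> * c"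
    using ex_dowling_approx_rep[of \<epsilon> S W R c] \<epsilon> W rk by auto
  have "(1 - k * (16 * \<epsilon>)) * c \<le> sdim (T s (0 + 2) \<inter> T s' (0 + 2))"
    by (rule approx_rep.agree_generators[OF rep s s' agree[OF rep]])
  also have "\<dots> \<le> 3 * \<epsilon> * c" by (rule T[OF s s' ne])
  finally have "1 - k * (16 * \<epsilon>) \<le> 3 * \<epsilon>" using c by simp
  then have "1 \<le> (16 * k + 3) * \<epsilon>" by (simp add: algebra_simps)
  then show False using k by (simp add: \<epsilon>_def)
qed

end
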